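(* Let $G=(V,E)$ be a finite simple undirected graph with maximum degree $\Delta$, let $q$ be a positive integer, let $\mathsf{X}=\{1,\ldots,q\}^V$, let $\mu_{v,0}$ ($v\in V$) be everywhere positive probability measures on $\{1,\ldots,q\}$, and let $\mu_0=\prod_{v\in V}\mu_{v,0}$. Suppose that all functions in the local cost classes $\Phi$ and $\Psi$ take values in $[-1,1]$, and that the parameter $\beta>0$ satisfies $\Delta\beta<1$. Then there is a positive constant $T_1=T_1(\beta,\Delta,|V|)$, independent of $T$, such that for every time horizon $T\ge 1$ the decentralized strategy based on the Glauber dynamics (defined in the context) attains the following worst-case regret: $$ \begin{aligned} R^{\rm LI}_T(\mathcal F)\le{}& \frac{|V|}{1-\Delta\beta}\left(2\beta^2|V|^3(\Delta+1)^2+K\left(|V|\ln\frac{q^2}{\theta_d}+\ln T\right)\right)\ln(T+1)\\ &+2\left(\beta|V|(\Delta+1)\right)^2\ln(T+1)+T_1|V|\ln\frac{q^2}{\theta_d}+\frac{2\beta|V|^3(\Delta+1)}{1-\Delta\beta}+\ln\frac1\theta, \end{aligned} $$ where $K=\max\{|V|,\ \beta|V|^2(\Delta+1)\}$, $\theta_d=\min_{v\in V}\min_{a\in\{1,\ldots,q\}}\mu_{v,0}(a)$, and $\theta=\min_{x\in\mathsf{X}}\mu_0(x)$.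
   Context: Graph and actions. For $v\in V$, $\partial v=\{u\in V:\{u,v\}\in E\}$ and $\Delta=\max_{v\in V}|\partial v|$. Elements $x=(x_v)_{v\in V}$ of $\mathsf{X}=\{1,\ldots,q\}^V$ are called network action profiles; $x_{\partial v}=(x_u)_{u\in\partial v}$ and $x_{-v}=(x_u)_{u\in V\setminus\{v\}}$. $\mathcal{P}(\mathsf{X})$ is the set of probability distributions on $\mathsf{X}$, $\langle\nu,f\rangle=\sum_{x\in\mathsf{X}}\nu(x)f(x)$, and $D(\nu\|\mu)=\sum_{x}\nu(x)\ln\frac{\nu(x)}{\mu(x)}$ is the relative entropy. $\mu_0(x)=\prod_{v\in V}\mu_{v,0}(x_v)$. Costs. $\Phi$ is a class of functions $\phi:\{1,\ldots,q\}\to\mathbb{R}$ and $\Psi$ is a class of functions $\psi:\{1,\ldots,q\}\times\{1,\ldots,q\}\to\mathbb{R}$. $\mathcal{F}=\mathcal{F}_{\Phi,\Psi}$ is the set of all functions $f:\mathsf{X}\to\mathbb{R}$ of the form $$f(x)=\sum_{v\in V}\phi_v(x_v)+\sum_{\{u,v\}\in E}\psi_{u,v}(x_u,x_v),\qquad \phi_v\in\Phi,\ \psi_{u,v}\in\Psi,$$ with one function $\psi_{u,v}$ per edge (for some ordering of its endpoints), and with the convention $\psi_{v,u}(b,a)=\psi_{u,v}(a,b)$. The local cost of such an $f$ at $v$ is $f_v(a,x_{\partial v})=\phi_v(a)+\sum_{u\in\partial v}\psi_{u,v}(x_u,a)$ for $a\in\{1,\ldots,q\}$. Strategy. The cost functions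 $f_1,\ldots,f_T\in\mathcal{F}$ (with given decompositions into local terms) are fixed in advance and $f_{v,s}$ denotes the local cost of $f_s$ at $v$. Put $F_{v,0}=0$ and $F_{v,t}=\frac{1}{t+1}\sum_{s=1}^t f_{v,s}$ for $t\ge1$. For $t=0,1,\ldots,T-1$ define the local update rules $$\mathbb{P}_{v,t+1}(a|x_{\partial v})=\frac{\mu_{v,0}(a)\exp(-\beta F_{v,t}(a,x_{\partial v}))}{\sum_{b=1}^q\mu_{v,0}(b)\exp(-\beta F_{v,t}(b,x_{\partial v}))}$$ and the Markov transition kernel on $\mathsf{X}$ $$\mathbb{P}_{t+1}(y|x)=\frac{1}{|V|}\sum_{v\in V}\mathbb{P}_{v,t+1}(y_v|x_{\partial v})\,\mathbf{1}_{\{y_{-v}=x_{-v}\}}.$$ (That is, at each time step one uniformly random agent $v$ is activated and resamples its action from $\mathbb{P}_{v,t+1}(\cdot|x_{\partial v})$, while all other agents replay their previous actions.) The action profiles $X_0,X_1,\ldots,X_T$ form the Markov chain with initial distribution $\mu_0$ and transition probabilities $\Pr(X_{t+1}=y|X_t=x)=\mathbb{P}_{t+1}(y|x)$; $\mu_t$ denotes the distribution of $X_t$. Regret. The instantaneous loss is $\ell_t(\nu)=\beta\langle\nu,f_t\rangle+D(\nu\|\mu_0)$ for $\nu\in\mathcal{P}(\mathsf{X})$. The regret of the decentralized (local interaction) strategy is $R^{\rm LI}_T(f^T)=\sum_{t=1}^T\ell_t(\mu_t)-\inf_{\nu\in\mathcal{P}(\mathsf{X})}\sum_{t=1}^T\ell_t(\nu)$,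 where $f^T=(f_1,\ldots,f_T)$, and the worst-case regret is $R^{\rm LI}_T(\mathcal{F})=\sup_{f_1,\ldots,f_T\in\mathcal{F}}R^{\rm LI}_T(f^T)$. *)

theory Defs
  imports "HOL-Probability.Probability"
begin

subsection \<open>Graphs and action profiles\<close>

definition simple_graph :: "'v set \<Rightarrow> 'v set set \<Rightarrow> bool" where
  "simple_graph V E \<longleftrightarrow> finite V \<and> V \<noteq> {} \<and> (\<forall>e\<in>E. e \<subseteq> V \<and> card e = 2)"

definition nbrs :: "'v set \<Rightarrow> 'v set set \<Rightarrow> 'v \<Rightarrow> 'v set" where
  "nbrs V E v = {u \<in> V. {u, v} \<in> E}"

definition max_degree :: "'v set \<Rightarrow> 'v set set \<Rightarrow> nat" where
  "max_degree V E = Max ((\<lambda>v. card (nbrs V E v)) ` V)"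

text \<open>A profile takes the value \<^term>\<open>undefined\<close> outside \<open>V\<close>, so that \<open>profiles V q\<close> is in
  bijection with the functions from \<open>V\<close> to \<open>{1..q}\<close>.\<close>

definition profiles :: "'v set \<Rightarrow> nat \<Rightarrow> ('v \<Rightarrow> nat) set" where
  "profiles V q = (V \<rightarrow>\<^sub>E {1..q})"

definition distributions :: "'v set \<Rightarrow> nat \<Rightarrow> ('v \<Rightarrow> nat) pmf set" where
  "distributions V q = {\<nu>. set_pmf \<nu> \<subseteq> profiles V q}"

definition initial_dist :: "'v set \<Rightarrow> ('v \<Rightarrow> nat pmf) \<Rightarrow> ('v \<Rightarrow> nat) pmf" where
  "initial_dist V \<mu> = Pi_pmf V undefined \<mu>"

text \<open>The convention \<open>0 ln 0 = 0\<close> is automatic. The value is meaningful only if \<open>\<mu>\<close> is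
  positive wherever \<open>\<nu>\<close> is; it is used only with \<open>\<mu>\<close> positive on all profiles.\<close>

definition rel_entropy :: "'v set \<Rightarrow> nat \<Rightarrow> ('v \<Rightarrow> nat) pmf \<Rightarrow> ('v \<Rightarrow> nat) pmf \<Rightarrow> real" where
  "rel_entropy V q \<nu> \<mu> = (\<Sum>x\<in>profiles V q. pmf \<nu> x * ln (pmf \<nu> x / pmf \<mu> x))"


subsection \<open>Cost functions\<close>

text \<open>A cost function is given by its decomposition \<open>(\<phi>, \<psi>)\<close> into local terms. Functions on
  \<open>{1..q}\<close> are represented by functions on all of \<^typ>\<open>nat\<close>, of which only the values on
  \<open>{1..q}\<close> are ever used.\<close>

type_synonym 'v local_terms = "('v \<Rightarrow> nat \<Rightarrow> real) \<times> ('v \<Rightarrow> 'v \<Rightarrow> nat \<Rightarrow> nat \<Rightarrow> real)"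

text \<open>For each edge, one of the two orientations of \<open>\<psi>\<close> is a member of \<open>\<Psi>\<close>; the other one
  is its transpose, which need not belong to \<open>\<Psi>\<close>.\<close>

definition decompositions ::
  "'v set \<Rightarrow> 'v set set \<Rightarrow> (nat \<Rightarrow> real) set \<Rightarrow> (nat \<Rightarrow> nat \<Rightarrow> real) set \<Rightarrow> 'v local_terms set" where
  "decompositions V E \<Phi> \<Psi> = {(\<phi>, \<psi>).
     (\<forall>v\<in>V. \<phi> v \<in> \<Phi>) \<and>
     (\<forall>u v. {u, v} \<in> E \<longrightarrow>
        (\<psi> u v \<in> \<Psi> \<or> \<psi> v u \<in> \<Psi>) \<and> (\<forall>a b. \<psi> v u b a = \<psi> u v a b))}"

text \<open>The value of the pair term at an unordered edge; it does not depend on how the endpoints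
  are ordered, see \<open>edge_term_eq\<close> below.\<close>

definition edge_term :: "('v \<Rightarrow> 'v \<Rightarrow> nat \<Rightarrow> nat \<Rightarrow> real) \<Rightarrow> ('v \<Rightarrow> nat) \<Rightarrow> 'v set \<Rightarrow> real" where
  "edge_term \<psi> x e = (THE c. \<exists>u v. e = {u, v} \<and> c = \<psi> u v (x u) (x v))"

lemma edge_term_eq:
  assumes "(\<phi>, \<psi>) \<in> decompositions V E \<Phi> \<Psi>" "{u, v} \<in> E"
  shows "edge_term \<psi> x {u, v} = \<psi> u v (x u) (x v)"
  unfolding edge_term_def
proof (rule the_equality)
  show "\<exists>u' v'. {u, v} = {u', v'} \<and> \<psi> u v (x u) (x v) = \<psi> u' v' (x u') (x v')"
    by blast
next
  fix c assume "\<exists>u' v'. {u, v} = {u', v'} \<and> c = \<psi> u' v' (x u') (x v')"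
  then show "c = \<psi> u v (x u) (x v)"
    using assms by (auto simp: decompositions_def doubleton_eq_iff)
qed

definition cost :: "'v set \<Rightarrow> 'v set set \<Rightarrow> 'v local_terms \<Rightarrow> ('v \<Rightarrow> nat) \<Rightarrow> real" where
  "cost V E d x = (\<Sum>v\<in>V. fst d v (x v)) + (\<Sum>e\<in>E. edge_term (snd d) x e)"

definition local_cost ::
  "'v set \<Rightarrow> 'v set set \<Rightarrow> 'v local_terms \<Rightarrow> 'v \<Rightarrow> nat \<Rightarrow> ('v \<Rightarrow> nat) \<Rightarrow> real" where
  "local_cost V E d v a x = fst d v a + (\<Sum>u\<in>nbrs V E v. snd d u v (x u) a)"


subsection \<open>The Glauber strategy\<close>

text \<open>The sequence \<open>d\<close> of decompositions is used at the indices \<open>1, 2, \<dots>\<close> only. The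
  normalisation is \<open>1 / (t + 1)\<close> although there are \<open>t\<close> summands; for \<open>t = 0\<close> the value is \<open>0\<close>.\<close>

definition avg_local_cost ::
  "'v set \<Rightarrow> 'v set set \<Rightarrow> (nat \<Rightarrow> 'v local_terms) \<Rightarrow> nat \<Rightarrow> 'v \<Rightarrow> nat \<Rightarrow> ('v \<Rightarrow> nat) \<Rightarrow> real" where
  "avg_local_cost V E d t v a x = 1 / (real t + 1) * (\<Sum>s=1..t. local_cost V E (d s) v a x)"

text \<open>In \<open>local_update\<close>, \<open>glauber_kernel\<close> the argument \<open>t\<close> gives the rule with index \<open>t + 1\<close>,
  that is, the one leading from time \<open>t\<close> to time \<open>t + 1\<close>.\<close>

definition local_update ::
  "'v set \<Rightarrow> 'v set set \<Rightarrow> nat \<Rightarrow> real \<Rightarrow> ('v \<Rightarrow> nat pmf) \<Rightarrow> (nat \<Rightarrow> 'v local_terms) \<Rightarrow>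
    nat \<Rightarrow> 'v \<Rightarrow> ('v \<Rightarrow> nat) \<Rightarrow> nat pmf" where
  "local_update V E q \<beta> \<mu> d t v x = embed_pmf (\<lambda>a. if a \<in> {1..q} then
      pmf (\<mu> v) a * exp (- \<beta> * avg_local_cost V E d t v a x) /
      (\<Sum>b=1..q. pmf (\<mu> v) b * exp (- \<beta> * avg_local_cost V E d t v b x))
    else 0)"

definition glauber_kernel ::
  "'v set \<Rightarrow> 'v set set \<Rightarrow> nat \<Rightarrow> real \<Rightarrow> ('v \<Rightarrow> nat pmf) \<Rightarrow> (nat \<Rightarrow> 'v local_terms) \<Rightarrow>
    nat \<Rightarrow> ('v \<Rightarrow> nat) \<Rightarrow> ('v \<Rightarrow> nat) pmf" where
  "glauber_kernel V E q \<beta> \<mu> d t x =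
     bind_pmf (pmf_of_set V) (\<lambda>v. map_pmf (\<lambda>a. x(v := a)) (local_update V E q \<beta> \<mu> d t v x))"

primrec action_dist ::
  "'v set \<Rightarrow> 'v set set \<Rightarrow> nat \<Rightarrow> real \<Rightarrow> ('v \<Rightarrow> nat pmf) \<Rightarrow> (nat \<Rightarrow> 'v local_terms) \<Rightarrow>
    nat \<Rightarrow> ('v \<Rightarrow> nat) pmf" where
  "action_dist V E q \<beta> \<mu> d 0 = initial_dist V \<mu>"
| "action_dist V E q \<beta> \<mu> d (Suc t) =
     bind_pmf (action_dist V E q \<beta> \<mu> d t) (glauber_kernel V E q \<beta> \<mu> d t)"

lemma pmf_local_update:
  assumes "q \<ge> 1" "set_pmf (\<mu> v) = {1..q}"
  shows "pmf (local_update V E q \<beta> \<mu> d t v x) a = (if a \<in> {1..q} then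
      pmf (\<mu> v) a * exp (- \<beta> * avg_local_cost V E d t v a x) /
      (\<Sum>b=1..q. pmf (\<mu> v) b * exp (- \<beta> * avg_local_cost V E d t v b x))
    else 0)"
proof -
  define w where "w a = pmf (\<mu> v) a * exp (- \<beta> * avg_local_cost V E d t v a x)" for a
  have w_pos: "w a > 0" if "a \<in> {1..q}" for a
    using that assms(2) by (auto simp: w_def pmf_positive_iff)
  have Z_pos: "(\<Sum>b=1..q. w b) > 0"
    using assms(1) w_pos by (intro sum_pos) auto
  let ?g = "\<lambda>a. if a \<in> {1..q} then w a / (\<Sum>b=1..q. w b) else 0"
  have nonneg: "?g a \<ge> 0" for a
    using w_pos[of a] Z_pos by (auto intro!: divide_nonneg_pos less_imp_le)
  have "(\<integral>\<^sup>+a. ennreal (?g a) \<partial>count_space UNIV) = (\<Sum>a\<in>{1..q}. ennreal (?g a))"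
    by (rule nn_integral_count_space') auto
  also have "\<dots> = ennreal (\<Sum>a\<in>{1..q}. ?g a)"
    using nonneg by (intro sum_ennreal) blast
  also have "(\<Sum>a\<in>{1..q}. ?g a) = 1"
    using Z_pos by (simp add: sum_divide_distrib [symmetric])
  finally have "(\<integral>\<^sup>+a. ennreal (?g a) \<partial>count_space UNIV) = 1" by simp
  from pmf_embed_pmf[of ?g, OF nonneg this] show ?thesis
    unfolding local_update_def w_def by blast
qed

lemma pmf_glauber_kernel:
  assumes "finite V" "V \<noteq> {}"
  shows "pmf (glauber_kernel V E q \<beta> \<mu> d t x) y =
    1 / real (card V) *
      (\<Sum>v\<in>V. pmf (local_update V E q \<beta> \<mu> d t v x) (y v) * of_bool (\<forall>u. u \<noteq> v \<longrightarrow> y u = x u))"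
proof -
  have *: "pmf (map_pmf (\<lambda>a. x(v := a)) p) y = pmf p (y v) * of_bool (\<forall>u. u \<noteq> v \<longrightarrow> y u = x u)"
    for v and p :: "nat pmf"
  proof (cases "\<forall>u. u \<noteq> v \<longrightarrow> y u = x u")
    case True
    then have y: "y = x(v := y v)" by auto
    have "inj (\<lambda>a. x(v := a))" by (auto simp: inj_def fun_eq_iff split: if_splits)
    from pmf_map_inj'[OF this, of p "y v"] show ?thesis
      using True y by simp
  next
    case False
    then have "y \<notin> (\<lambda>a. x(v := a)) ` set_pmf p" by auto
    then show ?thesis using False by (simp add: pmf_map_outside)
  qed
  show ?thesis
    using assms by (simp add: glauber_kernel_def pmf_bind integral_pmf_of_set *)
qed


subsection \<open>Regret\<close>

definition inst_loss ::
  "'v set \<Rightarrow> 'v set set \<Rightarrow> nat \<Rightarrow> real \<Rightarrow> ('v \<Rightarrow> nat pmf) \<Rightarrow> 'v local_terms \<Rightarrow>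
    ('v \<Rightarrow> nat) pmf \<Rightarrow> real" where
  "inst_loss V E q \<beta> \<mu> c \<nu> =
     \<beta> * (\<Sum>x\<in>profiles V q. pmf \<nu> x * cost V E c x) + rel_entropy V q \<nu> (initial_dist V \<mu>)"

text \<open>The infimum is one of reals; it is over a nonempty set bounded below, see
  \<open>bdd_below_total_loss\<close> and \<open>distributions_nonempty\<close>.\<close>

definition regret ::
  "'v set \<Rightarrow> 'v set set \<Rightarrow> nat \<Rightarrow> real \<Rightarrow> ('v \<Rightarrow> nat pmf) \<Rightarrow> (nat \<Rightarrow> 'v local_terms) \<Rightarrow>
    nat \<Rightarrow> real" where
  "regret V E q \<beta> \<mu> d T =
     (\<Sum>t=1..T. inst_loss V E q \<beta> \<mu> (d t) (action_dist V E q \<beta> \<mu> d t)) -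
     (INF \<nu>\<in>distributions V q. \<Sum>t=1..T. inst_loss V E q \<beta> \<mu> (d t) \<nu>)"

text \<open>The supremum is taken in the extended reals, so that it needs no boundedness proviso.\<close>

definition worst_regret ::
  "'v set \<Rightarrow> 'v set set \<Rightarrow> nat \<Rightarrow> real \<Rightarrow> ('v \<Rightarrow> nat pmf) \<Rightarrow> (nat \<Rightarrow> real) set \<Rightarrow>
    (nat \<Rightarrow> nat \<Rightarrow> real) set \<Rightarrow> nat \<Rightarrow> ereal" where
  "worst_regret V E q \<beta> \<mu> \<Phi> \<Psi> T =
     (SUP d \<in> {1..T} \<rightarrow> decompositions V E \<Phi> \<Psi>. ereal (regret V E q \<beta> \<mu> d T))"

lemma initial_dist_in_distributions:
  assumes "finite V" "\<And>v. v \<in> V \<Longrightarrow> set_pmf (\<mu> v) = {1..q}"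
  shows "initial_dist V \<mu> \<in> distributions V q"
proof -
  have "set_pmf (initial_dist V \<mu>) = PiE_dflt V undefined (set_pmf \<circ> \<mu>)"
    unfolding initial_dist_def by (rule set_Pi_pmf[OF assms(1)])
  also have "\<dots> \<subseteq> profiles V q"
  proof
    fix x assume x: "x \<in> PiE_dflt V undefined (set_pmf \<circ> \<mu>)"
    show "x \<in> profiles V q"
      unfolding profiles_def
    proof (rule PiE_I)
      fix v assume v: "v \<in> V"
      with x have "x v \<in> set_pmf (\<mu> v)" by (simp add: PiE_dflt_def)
      with assms(2)[OF v] show "x v \<in> {1..q}" by simp
    next
      fix v assume "v \<notin> V"
      with x show "x v = undefined" by (simp add: PiE_dflt_def)
    qed
  qed
  finally show ?thesis by (simp add: distributions_def)
qed

lemma distributions_nonempty: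
  assumes "finite V" "\<And>v. v \<in> V \<Longrightarrow> set_pmf (\<mu> v) = {1..q}"
  shows "distributions V q \<noteq> {}"
proof -
  have "initial_dist V \<mu> \<in> distributions V q"
    using assms by (rule initial_dist_in_distributions)
  then show ?thesis by (metis empty_iff)
qed

lemma bdd_below_total_loss:
  assumes "finite V" "\<And>v. v \<in> V \<Longrightarrow> set_pmf (\<mu> v) = {1..q}"
  shows "bdd_below ((\<lambda>\<nu>. \<Sum>t=1..T. inst_loss V E q \<beta> \<mu> (d t) \<nu>) ` distributions V q)"
proof -
  let ?X = "profiles V q" and ?m = "initial_dist V \<mu>"
  have m_pos: "pmf ?m x > 0" if "x \<in> ?X" for x
  proof -
    have "pmf ?m x = (\<Prod>v\<in>V. pmf (\<mu> v) (x v))"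
      using that assms(1) unfolding initial_dist_def
      by (intro pmf_Pi') (auto simp: profiles_def PiE_iff extensional_def)
    also have "\<dots> > 0"
      using that assms by (intro prod_pos) (auto simp: pmf_positive_iff profiles_def PiE_iff)
    finally show ?thesis .
  qed
  have ent: "pmf \<nu> x * ln (pmf \<nu> x / pmf ?m x) \<ge> - pmf ?m x" if "x \<in> ?X" for x \<nu>
  proof (cases "pmf \<nu> x = 0")
    case False
    then have n: "pmf \<nu> x > 0" by (simp add: pmf_nonneg order.strict_iff_order)
    have "ln (pmf ?m x / pmf \<nu> x) \<le> pmf ?m x / pmf \<nu> x - 1"
      using n m_pos[OF that] by (intro ln_le_minus_one) auto
    then have "pmf \<nu> x * ln (pmf ?m x / pmf \<nu> x) \<le> pmf \<nu> x * (pmf ?m x / pmf \<nu> x - 1)"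
      using n by (intro mult_left_mono) auto
    also have "\<dots> = pmf ?m x - pmf \<nu> x" using n by (simp add: field_simps)
    finally show ?thesis
      using n m_pos[OF that] by (simp add: ln_div algebra_simps)
  qed simp
  have lin: "pmf \<nu> x * r \<ge> - \<bar>r\<bar>" for \<nu> :: "('a \<Rightarrow> nat) pmf" and x and r :: real
  proof -
    have "\<bar>pmf \<nu> x * r\<bar> \<le> 1 * \<bar>r\<bar>"
      unfolding abs_mult by (intro mult_right_mono) (auto simp: pmf_le_1)
    then show ?thesis by linarith
  qed
  have "(\<Sum>t=1..T. (\<Sum>x\<in>?X. - \<bar>\<beta> * cost V E (d t) x\<bar>) + (\<Sum>x\<in>?X. - pmf ?m x))
          \<le> (\<Sum>t=1..T. inst_loss V E q \<beta> \<mu> (d t) \<nu>)" for \<nu>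
  proof (rule sum_mono)
    fix t
    have "(\<Sum>x\<in>?X. - \<bar>\<beta> * cost V E (d t) x\<bar>) \<le> (\<Sum>x\<in>?X. pmf \<nu> x * (\<beta> * cost V E (d t) x))"
      by (intro sum_mono lin)
    moreover have "(\<Sum>x\<in>?X. - pmf ?m x) \<le> rel_entropy V q \<nu> ?m"
      unfolding rel_entropy_def by (intro sum_mono ent)
    ultimately show "(\<Sum>x\<in>?X. - \<bar>\<beta> * cost V E (d t) x\<bar>) + (\<Sum>x\<in>?X. - pmf ?m x)
        \<le> inst_loss V E q \<beta> \<mu> (d t) \<nu>"
      by (simp add: inst_loss_def sum_distrib_left mult.left_commute)
  qed
  then show ?thesis by (rule bdd_belowI2)
qed

end

theory Submission
  imports Defs
begin

text \<open>
  The Gibbs measure \<open>\<pi>\<^sub>t\<^sub>+\<^sub>1\<close> proportional to \<open>\<mu>\<^sub>0 exp(-\<beta> F\<^sub>t)\<close>, where \<open>F\<^sub>t\<close> is the average of the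
  first \<open>t\<close> costs, is invariant under the Glauber kernel \<open>P\<^sub>t\<^sub>+\<^sub>1\<close>, and it is what
  follow-the-regularised-leader plays at time \<open>t + 1\<close>. Hence the regret of \<open>\<pi>\<close> is logarithmic, and it
  remains to compare \<open>\<mu>\<^sub>t\<close> with \<open>\<pi>\<^sub>t\<close>. If \<open>\<Delta>\<beta> < 1\<close>, the kernels contract the Wasserstein distance for
  the Hamming metric by \<open>1 - (1 - \<Delta>\<beta>) / |V|\<close>, while \<open>\<pi>\<^sub>t\<close> drifts by \<open>O(1/t)\<close> per step, so the total
  variation distances sum up to \<open>O(ln T)\<close>. Since \<open>\<pi>\<^sub>t\<close> minimises a free energy, the loss difference is a
  linear term plus the divergence \<open>D(\<mu>\<^sub>t | \<pi>\<^sub>t)\<close>, which is at most the total variation distance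
  times \<open>1 + ln (1 / min \<pi>\<^sub>t)\<close>.
\<close>

subsection \<open>Total variation and relative entropy on finite sets\<close>

text \<open>The slope in \<open>s\<close> of
  \<open>U * exp (- s) / (U * exp (- s) + W * exp s)\<close> is
  \<open>- 2 * a * b / (a + b)^2\<close>, where \<open>a\<close> and \<open>b\<close> are the two
  terms of the denominator. By \<open>4 * a * b \<le> (a + b)^2\<close> it is at least -1/2, so
  adding \<open>s / 2\<close> gives a nondecreasing function.\<close>

lemma logistic_diff_le:
  fixes U W c :: real
  assumes "U \<ge> 0" "W \<ge> 0" "U + W > 0" "c \<ge> 0"
  shows "U / (U + W) - U * exp (- c) / (U * exp (- c) + W * exp c) \<le> c / 2"
proof -
  let ?f = "\<lambda>s. U * exp (- s) / (U * exp (- s) + W * exp s) + s / 2"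
  have "?f 0 \<le> ?f c"
  proof (rule DERIV_nonneg_imp_nondecreasing[OF assms(4)])
    fix s :: real
    let ?a = "U * exp (- s)" and ?b = "W * exp s"
    have pos: "?a + ?b > 0"
    proof (cases "U = 0")
      case False
      then show ?thesis using assms by (intro add_pos_nonneg) auto
    qed (use assms in auto)
    have "4 * (?a * ?b) \<le> (?a + ?b)^2"
      using zero_le_power2[of "?a - ?b"] by (simp add: power2_eq_square algebra_simps)
    then have "2 * (?a * ?b) / (?a + ?b)^2 \<le> 1 / 2"
      using pos by (simp add: divide_simps)
    moreover have "(?f has_real_derivative
        ((U * (exp (- s) * - 1)) * (?a + ?b) - ?a * (U * (exp (- s) * - 1) + W * exp s)) /
          ((?a + ?b) * (?a + ?b)) + 1 / 2) (at s)"
      using pos by (intro derivative_intros DERIV_divide) (auto intro!: derivative_eq_intros)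
    moreover have "((U * (exp (- s) * - 1)) * (?a + ?b) - ?a * (U * (exp (- s) * - 1) + W * exp s)) /
          ((?a + ?b) * (?a + ?b)) = - 2 * (?a * ?b) / (?a + ?b)^2"
      by (simp add: power2_eq_square algebra_simps)
    ultimately show "\<exists>y. (?f has_real_derivative y) (at s) \<and> 0 \<le> y"
      by (intro exI[of _ "- 2 * (?a * ?b) / (?a + ?b)^2 + 1 / 2"]) simp
  qed
  moreover have "?f 0 = U / (U + W)" by simp
  ultimately show ?thesis by linarith
qed

lemma frac_le_cross:
  fixes a b a' b' :: real
  assumes "a > 0" "b \<ge> 0" "a' > 0" "b' \<ge> 0" "a * b' \<le> a' * b"
  shows "a / (a + b) \<le> a' / (a' + b')"
proof -
  have "a + b > 0" "a' + b' > 0" using assms by linarith+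
  then show ?thesis using assms(5) by (simp add: divide_simps algebra_simps)
qed

text \<open>The mass of \<open>B\<close> drops most if every weight in \<open>B\<close> shrinks by
  the factor \<open>exp (- c)\<close> and every other weight grows by \<open>exp c\<close>. This
  reduces the claim to the two masses \<open>U\<close> and \<open>W\<close>, that is, to
  \<open>logistic_diff_le\<close>. The factor 1/2 is what later puts the threshold at
  \<Delta>\<beta> < 1.\<close>

lemma normalized_mass_diff_le:
  fixes w w' :: "'a \<Rightarrow> real"
  assumes A: "finite A" "A \<noteq> {}" "B \<subseteq> A"
    and w: "\<And>a. a \<in> A \<Longrightarrow> w a > 0"
    and lo: "\<And>a. a \<in> A \<Longrightarrow> exp (- c) * w a \<le> w' a"
    and hi: "\<And>a. a \<in> A \<Longrightarrow> w' a \<le> exp c * w a"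
  shows "sum w B / sum w A - sum w' B / sum w' A \<le> c / 2"
proof -
  define U W U' W' where "U = sum w B" and "W = sum w (A - B)"
    and "U' = sum w' B" and "W' = sum w' (A - B)"
  have split: "sum g A = sum g B + sum g (A - B)" for g :: "'a \<Rightarrow> real"
    using A by (metis add.commute sum.subset_diff)
  have c: "c \<ge> 0"
  proof -
    obtain a where a: "a \<in> A" using A by blast
    have "exp (- c) * w a \<le> exp c * w a" using lo[OF a] hi[OF a] by linarith
    then show ?thesis using w[OF a] by simp
  qed
  have U: "U \<ge> 0" "W \<ge> 0"
    unfolding U_def W_def using A w by (auto intro!: sum_nonneg simp: less_imp_le subset_eq)
  have UW: "U + W > 0"
    using split[of w] sum_pos[of A w] A w by (simp add: U_def W_def)
  have U': "exp (- c) * U \<le> U'"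
    unfolding U_def U'_def sum_distrib_left using A lo by (intro sum_mono) auto
  have W': "W' \<le> exp c * W"
    unfolding W_def W'_def sum_distrib_left using A hi by (intro sum_mono) auto
  have w': "w' a > 0" if "a \<in> A" for a
    using mult_pos_pos[OF exp_gt_zero w[OF that], of "- c"] lo[OF that] by linarith
  have W'0: "W' \<ge> 0"
    unfolding W'_def using w' by (auto intro!: sum_nonneg simp: less_imp_le)
  have "U * exp (- c) / (U * exp (- c) + W * exp c) \<le> U' / (U' + W')"
  proof (cases "U = 0")
    case True
    then show ?thesis using U' W'0 by simp
  next
    case False
    then have p: "U * exp (- c) > 0" using U by simp
    have "U * exp (- c) * W' \<le> U' * (W * exp c)"
      using U' W' W'0 U p by (intro mult_mono) (auto simp: mult.commute)
    moreover have "U' > 0" using p U' by (simp add: mult.commute)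
    moreover have "W * exp c \<ge> 0" using U by simp
    ultimately show ?thesis
      using p W'0 frac_le_cross by blast
  qed
  moreover have "U / (U + W) - U * exp (- c) / (U * exp (- c) + W * exp c) \<le> c / 2"
    using logistic_diff_le U UW c by blast
  ultimately show ?thesis
    unfolding split[of w] split[of w'] U_def[symmetric] W_def[symmetric] U'_def[symmetric] W'_def[symmetric]
    by linarith
qed

text \<open>The total variation distance, if \<open>p\<close> and \<open>p'\<close> are probability vectors.\<close>

definition excess :: "'a set \<Rightarrow> ('a \<Rightarrow> real) \<Rightarrow> ('a \<Rightarrow> real) \<Rightarrow> real" where
  "excess A p p' = (\<Sum>a\<in>{a \<in> A. p a > p' a}. p a - p' a)"

text \<open>As the total masses agree, a constant can be subtracted from \<open>h\<close>. Taking
  the minimum makes \<open>h\<close> range over \<open>[0, r]\<close>, so points with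
  \<open>p a \<le> p' a\<close> contribute at most 0 and the others at most
  \<open>r * (p a - p' a)\<close>.\<close>

lemma sum_diff_le_excess:
  fixes p p' h :: "'a \<Rightarrow> real"
  assumes "finite A" "A \<noteq> {}" "sum p A = sum p' A"
    and osc: "\<And>a b. a \<in> A \<Longrightarrow> b \<in> A \<Longrightarrow> h a - h b \<le> r"
  shows "(\<Sum>a\<in>A. (p a - p' a) * h a) \<le> r * excess A p p'"
proof -
  define l where "l = Min (h ` A)"
  have l: "0 \<le> h a - l" "h a - l \<le> r" if "a \<in> A" for a
  proof -
    have "l \<in> h ` A" unfolding l_def using assms by (intro Min_in) auto
    then show "h a - l \<le> r" using osc that by auto
    show "0 \<le> h a - l" unfolding l_def using assms that by simp
  qed
  have "(\<Sum>a\<in>A. (p a - p' a) * h a) = (\<Sum>a\<in>A. (p a - p' a) * (h a - l)) + l * (sum p A - sum p' A)"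
    by (simp add: algebra_simps sum.distrib sum_subtractf sum_distrib_left)
  also have "\<dots> = (\<Sum>a\<in>A. (p a - p' a) * (h a - l))" using assms by simp
  also have "\<dots> \<le> (\<Sum>a\<in>A. if p a > p' a then r * (p a - p' a) else 0)"
  proof (rule sum_mono)
    fix a assume a: "a \<in> A"
    show "(p a - p' a) * (h a - l) \<le> (if p a > p' a then r * (p a - p' a) else 0)"
      using l[OF a] mult_left_mono[of "h a - l" r "p a - p' a"]
      by (auto simp: mult.commute mult_nonneg_nonpos2 mult_nonneg_nonpos)
  qed
  also have "\<dots> = r * excess A p p'"
    unfolding excess_def sum_distrib_left using assms(1) by (simp add: sum.If_cases Int_def)
  finally show ?thesis .
qed

text \<open>The excess is the difference of the two normalised masses of the set where the first
  vector is larger, hence at most \<open>c / 2\<close>; the pairing with \<open>h\<close> costs the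
  oscillation \<open>r\<close>. The other sign follows with \<open>- h\<close>.\<close>

lemma normalized_sum_diff_le:
  fixes w w' h :: "'a \<Rightarrow> real"
  assumes A: "finite A" "A \<noteq> {}"
    and w: "\<And>a. a \<in> A \<Longrightarrow> w a > 0"
    and lo: "\<And>a. a \<in> A \<Longrightarrow> exp (- c) * w a \<le> w' a"
    and hi: "\<And>a. a \<in> A \<Longrightarrow> w' a \<le> exp c * w a"
    and osc: "\<And>a b. a \<in> A \<Longrightarrow> b \<in> A \<Longrightarrow> h a - h b \<le> r"
  shows "\<bar>\<Sum>a\<in>A. (w a / sum w A - w' a / sum w' A) * h a\<bar> \<le> c / 2 * r"
proof -
  have w': "w' a > 0" if "a \<in> A" for a
    using w[OF that] lo[OF that] by (smt (verit) exp_gt_zero mult_pos_pos)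
  have Z: "sum w A > 0" "sum w' A > 0" using A w w' by (auto intro!: sum_pos)
  let ?p = "\<lambda>a. w a / sum w A" and ?p' = "\<lambda>a. w' a / sum w' A"
  have r: "r \<ge> 0" using A osc by (metis ex_in_conv diff_self)
  have eq: "sum ?p A = sum ?p' A"
    using Z by (simp add: sum_divide_distrib[symmetric])
  have "excess A ?p ?p' = sum w {a\<in>A. ?p a > ?p' a} / sum w A - sum w' {a\<in>A. ?p a > ?p' a} / sum w' A"
    by (simp add: excess_def sum_subtractf sum_divide_distrib)
  also have "\<dots> \<le> c / 2"
    by (rule normalized_mass_diff_le) (use A w lo hi in auto)
  finally have ex: "excess A ?p ?p' \<le> c / 2" .
  have "(\<Sum>a\<in>A. (?p a - ?p' a) * h a) \<le> r * excess A ?p ?p'"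
    using sum_diff_le_excess[OF A eq] osc by blast
  moreover have "(\<Sum>a\<in>A. (?p a - ?p' a) * (- h a)) \<le> r * excess A ?p ?p'"
    using sum_diff_le_excess[OF A eq, of "\<lambda>a. - h a" r] osc by simp
  moreover have "r * excess A ?p ?p' \<le> r * (c / 2)"
    using ex r by (rule mult_left_mono)
  ultimately show ?thesis by (simp add: sum_negf abs_le_iff mult.commute)
qed

lemma exp_mult_bounds:
  fixes m g g' c :: real
  assumes "\<bar>g' - g\<bar> \<le> c" "m > 0"
  shows "exp (- c) * (m * exp (- g)) \<le> m * exp (- g')" "m * exp (- g') \<le> exp c * (m * exp (- g))"
proof -
  have "exp (- c + - g) \<le> exp (- g')" "exp (- g') \<le> exp (c + - g)" using assms by auto
  then have "m * (exp (- c) * exp (- g)) \<le> m * exp (- g')" "m * exp (- g') \<le> m * (exp c * exp (- g))"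
    using assms(2) unfolding exp_add by (auto intro: mult_left_mono)
  then show "exp (- c) * (m * exp (- g)) \<le> m * exp (- g')" "m * exp (- g') \<le> exp c * (m * exp (- g))"
    by (simp_all only: mult.left_commute)
qed

text \<open>Relative entropy for real-valued vectors, so that it applies to the Gibbs measures,
  which are plain functions and not of type \<open>pmf\<close>.\<close>

definition kl :: "'a set \<Rightarrow> ('a \<Rightarrow> real) \<Rightarrow> ('a \<Rightarrow> real) \<Rightarrow> real" where
  "kl A p g = (\<Sum>a\<in>A. p a * ln (p a / g a))"

lemma mult_ln_divide_ge:
  fixes x y :: real
  assumes "x \<ge> 0" "y > 0"
  shows "x * ln (x / y) \<ge> x - y"
proof (cases "x = 0")
  case False
  then have x: "x > 0" using assms by simp
  have "ln (y / x) \<le> y / x - 1" using x assms by (intro ln_le_minus_one) auto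
  then have "x * ln (y / x) \<le> x * (y / x - 1)" using x by (intro mult_left_mono) auto
  then show ?thesis using x assms by (simp add: ln_div algebra_simps)
qed (use assms in auto)

lemma kl_nonneg:
  assumes "\<And>a. a \<in> A \<Longrightarrow> p a \<ge> 0" "\<And>a. a \<in> A \<Longrightarrow> g a > 0" "sum p A = sum g A"
  shows "kl A p g \<ge> 0"
proof -
  have "0 = (\<Sum>a\<in>A. p a - g a)" using assms by (simp add: sum_subtractf)
  also have "\<dots> \<le> kl A p g"
    unfolding kl_def using assms by (intro sum_mono mult_ln_divide_ge) auto
  finally show ?thesis .
qed

text \<open>Only points with \<open>p a > g a\<close> can contribute positively. There
  \<open>p = (p - g) + g\<close>: the first part of \<open>p * ln (p / g)\<close> is at most
  \<open>(p - g) * L\<close> because \<open>p \<le> 1\<close>, and the second is at most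
  \<open>p - g\<close> by \<open>ln z \<le> z - 1\<close>.\<close>

lemma kl_le_excess:
  assumes A: "finite A" and p: "\<And>a. a \<in> A \<Longrightarrow> p a \<ge> 0" "\<And>a. a \<in> A \<Longrightarrow> p a \<le> 1"
    and g: "\<And>a. a \<in> A \<Longrightarrow> g a > 0" "\<And>a. a \<in> A \<Longrightarrow> ln (1 / g a) \<le> L"
  shows "kl A p g \<le> (1 + L) * excess A p g"
proof -
  have "kl A p g \<le> (\<Sum>a\<in>A. if p a > g a then (1 + L) * (p a - g a) else 0)"
    unfolding kl_def
  proof (rule sum_mono)
    fix a assume a: "a \<in> A"
    show "p a * ln (p a / g a) \<le> (if p a > g a then (1 + L) * (p a - g a) else 0)"
    proof (cases "p a > g a")
      case True
      have g0: "g a > 0" and p1: "p a \<le> 1" using a g p by auto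
      have "ln (p a / g a) \<le> ln (1 / g a)"
        using True g0 p1 by (intro ln_mono) (auto simp: divide_right_mono)
      then have "ln (p a / g a) \<le> L" using g(2)[OF a] by linarith
      then have "(p a - g a) * ln (p a / g a) \<le> (p a - g a) * L"
        using True by (intro mult_left_mono) auto
      moreover have "g a * ln (p a / g a) \<le> p a - g a"
        using mult_ln_divide_ge[of "g a" "p a"] True g0 by (simp add: ln_div algebra_simps)
      ultimately show ?thesis using True by (simp add: algebra_simps)
    next
      case False
      then have "ln (p a / g a) \<le> 0" if "p a > 0"
        using that g(1)[OF a] by (subst ln_le_zero_iff) auto
      then have "p a * ln (p a / g a) \<le> 0"
        using p(1)[OF a] by (cases "p a = 0") (auto intro!: mult_nonneg_nonpos)
      then show ?thesis using False by simp
    qed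
  qed
  also have "\<dots> = (1 + L) * excess A p g"
    unfolding excess_def sum_distrib_left using A by (simp add: sum.If_cases Int_def)
  finally show ?thesis .
qed

text \<open>Each summand is at most \<open>ln (t + 2) - ln (t + 1)\<close>, and these differences
  telescope.\<close>

lemma harmonic_le_ln: "(\<Sum>t<T. 1 / (real t + 2)) \<le> ln (real T + 1)"
proof (induction T)
  case (Suc T)
  have "ln ((real T + 1) / (real T + 2)) \<le> (real T + 1) / (real T + 2) - 1"
    by (intro ln_le_minus_one) auto
  also have "\<dots> = - (1 / (real T + 2))" by (simp add: field_simps)
  finally have "1 / (real T + 2) \<le> ln (real T + 2) - ln (real T + 1)"
    by (simp add: ln_div)
  then show ?case using Suc by (simp add: add.commute)
qed simp


subsection \<open>Locality of the costs\<close>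

text \<open>Valid decompositions are assumed at every index, so that no horizon enters the locale; a
  finite cost sequence is padded before the locale is interpreted.\<close>

locale network_game =
  fixes V :: "'v set" and E :: "'v set set" and q :: nat and \<mu> :: "'v \<Rightarrow> nat pmf"
    and \<beta> :: real and \<Phi> :: "(nat \<Rightarrow> real) set" and \<Psi> :: "(nat \<Rightarrow> nat \<Rightarrow> real) set"
    and d :: "nat \<Rightarrow> 'v local_terms"
  assumes graph: "simple_graph V E"
    and q_pos: "q \<ge> 1"
    and mu_supp: "\<And>v. v \<in> V \<Longrightarrow> set_pmf (\<mu> v) = {1..q}"
    and Phi_bound: "\<And>\<phi> a. \<phi> \<in> \<Phi> \<Longrightarrow> a \<in> {1..q} \<Longrightarrow> \<bar>\<phi> a\<bar> \<le> 1"
    and Psi_bound: "\<And>\<psi> a b. \<psi> \<in> \<Psi> \<Longrightarrow> a \<in> {1..q} \<Longrightarrow> b \<in> {1..q} \<Longrightarrow> \<bar>\<psi> a b\<bar> \<le> 1"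
    and beta_pos: "\<beta> > 0"
    and subcritical: "real (max_degree V E) * \<beta> < 1"
    and decomp: "\<And>t. d t \<in> decompositions V E \<Phi> \<Psi>"
begin

abbreviation "X \<equiv> profiles V q"
abbreviation "m \<equiv> pmf (initial_dist V \<mu>)"
abbreviation "N \<equiv> real (card V)"
abbreviation "\<Delta> \<equiv> real (max_degree V E)"

lemma finite_V: "finite V" and V_ne: "V \<noteq> {}"
  using graph by (auto simp: simple_graph_def)

lemma N_ge_1: "N \<ge> 1"
  using finite_V V_ne by (simp add: Suc_leI card_gt_0_iff)

lemma finite_X: "finite X"
  unfolding profiles_def using finite_V by (intro finite_PiE) auto

lemma X_ne: "X \<noteq> {}"
  using q_pos by (simp add: profiles_def PiE_eq_empty_iff)

lemma X_val: "x \<in> X \<Longrightarrow> v \<in> V \<Longrightarrow> x v \<in> {1..q}"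
  by (auto simp: profiles_def)

lemma X_upd: "x \<in> X \<Longrightarrow> v \<in> V \<Longrightarrow> a \<in> {1..q} \<Longrightarrow> x(v := a) \<in> X"
  using PiE_fun_upd[of a "\<lambda>_. {1..q}" v x V] by (simp add: profiles_def insert_absorb)

lemma m_eq: "x \<in> X \<Longrightarrow> m x = (\<Prod>v\<in>V. pmf (\<mu> v) (x v))"
  using finite_V unfolding initial_dist_def
  by (intro pmf_Pi') (auto simp: profiles_def PiE_iff extensional_def)

lemma mu_pos: "v \<in> V \<Longrightarrow> a \<in> {1..q} \<Longrightarrow> pmf (\<mu> v) a > 0"
  using mu_supp by (simp add: pmf_positive_iff)

lemma m_pos: "x \<in> X \<Longrightarrow> m x > 0"
  by (auto simp: m_eq intro!: prod_pos mu_pos X_val)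

lemma m_upd:
  assumes "x \<in> X" "v \<in> V" "a \<in> {1..q}"
  shows "m (x(v := a)) = pmf (\<mu> v) a * (\<Prod>u\<in>V - {v}. pmf (\<mu> u) (x u))"
proof -
  have "m (x(v := a)) = (\<Prod>u\<in>V. pmf (\<mu> u) ((x(v := a)) u))"
    by (rule m_eq) (rule X_upd[OF assms])
  also have "\<dots> = pmf (\<mu> v) a * (\<Prod>u\<in>V - {v}. pmf (\<mu> u) ((x(v := a)) u))"
    using finite_V assms by (subst prod.remove[of V v]) auto
  also have "(\<Prod>u\<in>V - {v}. pmf (\<mu> u) ((x(v := a)) u)) = (\<Prod>u\<in>V - {v}. pmf (\<mu> u) (x u))"
    by (intro prod.cong) auto
  finally show ?thesis .
qed

lemma edge_doubleton: "e \<in> E \<Longrightarrow> \<exists>u v. u \<in> V \<and> v \<in> V \<and> u \<noteq> v \<and> e = {u, v}"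
  using graph by (fastforce simp: simple_graph_def card_2_iff)

lemma nbrs_sym: "u \<in> V \<Longrightarrow> v \<in> V \<Longrightarrow> u \<in> nbrs V E v \<longleftrightarrow> v \<in> nbrs V E u"
  by (auto simp: nbrs_def insert_commute)

lemma nbrs_irrefl: "v \<notin> nbrs V E v"
  using graph by (auto simp: nbrs_def simple_graph_def)

lemma finite_nbrs: "finite (nbrs V E v)"
  using finite_V by (simp add: nbrs_def)

lemma card_nbrs_le: "v \<in> V \<Longrightarrow> real (card (nbrs V E v)) \<le> \<Delta>"
  unfolding max_degree_def using finite_V by simp

lemma incident_edges: "v \<in> V \<Longrightarrow> {e \<in> E. v \<in> e} = (\<lambda>u. {u, v}) ` nbrs V E v"
  using edge_doubleton by (fastforce simp: nbrs_def insert_commute)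

lemma finite_E: "finite E"
proof (rule finite_subset)
  show "E \<subseteq> Pow V" using graph by (auto simp: simple_graph_def)
  show "finite (Pow V)" using finite_V by simp
qed

text \<open>A union bound over the stars of the vertices. Every edge is counted at both ends, so
  this is twice the handshake bound.\<close>

lemma card_E_le: "real (card E) \<le> N * \<Delta>"
proof -
  have "E \<subseteq> (\<Union>v\<in>V. (\<lambda>u. {u, v}) ` nbrs V E v)"
    using edge_doubleton incident_edges by blast
  then have "card E \<le> card (\<Union>v\<in>V. (\<lambda>u. {u, v}) ` nbrs V E v)"
    using finite_V finite_nbrs by (intro card_mono) auto
  also have "\<dots> \<le> (\<Sum>v\<in>V. card ((\<lambda>u. {u, v}) ` nbrs V E v))"
    using finite_V by (rule card_UN_le)
  also have "\<dots> \<le> (\<Sum>v\<in>V. card (nbrs V E v))"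
    by (intro sum_mono card_image_le finite_nbrs)
  finally have "real (card E) \<le> (\<Sum>v\<in>V. real (card (nbrs V E v)))"
    by (metis of_nat_le_iff of_nat_sum)
  also have "\<dots> \<le> (\<Sum>v\<in>V. \<Delta>)" by (intro sum_mono card_nbrs_le)
  finally show ?thesis by simp
qed

lemma edge_term_doubleton: "{u, v} \<in> E \<Longrightarrow> edge_term (snd (d t)) x {u, v} = snd (d t) u v (x u) (x v)"
  by (rule edge_term_eq[of "fst (d t)" _ V E \<Phi> \<Psi>]) (use decomp in auto)

lemma phi_le: "v \<in> V \<Longrightarrow> a \<in> {1..q} \<Longrightarrow> \<bar>fst (d t) v a\<bar> \<le> 1"
  using decomp[of t] by (intro Phi_bound) (auto simp: decompositions_def)

lemma psi_decomp:
  "{u, v} \<in> E \<Longrightarrow> (snd (d t) u v \<in> \<Psi> \<or> snd (d t) v u \<in> \<Psi>) \<and> snd (d t) v u b a = snd (d t) u v a b"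
  using decomp[of t] by (auto simp: decompositions_def mem_Times_iff)

lemma psi_le:
  assumes "{u, v} \<in> E" "a \<in> {1..q}" "b \<in> {1..q}"
  shows "\<bar>snd (d t) u v a b\<bar> \<le> 1"
proof -
  have "snd (d t) u v \<in> \<Psi> \<or> snd (d t) v u \<in> \<Psi>" and sym: "snd (d t) v u b a = snd (d t) u v a b"
    using psi_decomp[OF assms(1)] by blast+
  then show ?thesis
    using Psi_bound[of "snd (d t) u v" a b] Psi_bound[of "snd (d t) v u" b a] assms by auto
qed

lemma cost_bound: "x \<in> X \<Longrightarrow> \<bar>cost V E (d t) x\<bar> \<le> N * (\<Delta> + 1)"
proof -
  assume x: "x \<in> X"
  have "\<bar>\<Sum>v\<in>V. fst (d t) v (x v)\<bar> \<le> (\<Sum>v\<in>V. 1)"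
    using x by (intro order_trans[OF sum_abs] sum_mono phi_le X_val) auto
  moreover have "\<bar>\<Sum>e\<in>E. edge_term (snd (d t)) x e\<bar> \<le> (\<Sum>e\<in>E. 1)"
  proof (intro order_trans[OF sum_abs] sum_mono)
    fix e assume e: "e \<in> E"
    then obtain u v where "u \<in> V" "v \<in> V" "e = {u, v}" using edge_doubleton by blast
    then show "\<bar>edge_term (snd (d t)) x e\<bar> \<le> 1"
      using e psi_le[of u v "x u" "x v" t] X_val[OF x] by (simp add: edge_term_doubleton)
  qed
  ultimately show ?thesis
    unfolding cost_def using card_E_le by (simp add: algebra_simps)
qed

lemma local_cost_upd: "local_cost V E c v b (x(v := a)) = local_cost V E c v b x"
  unfolding local_cost_def using nbrs_irrefl[of v] by (auto intro!: sum.cong)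

text \<open>The edges at \<open>v\<close> correspond bijectively to the neighbours of
  \<open>v\<close>, so the terms of the cost that involve \<open>v\<close> add up to the local cost;
  the bracket collects the rest.\<close>

lemma cost_split:
  assumes v: "v \<in> V"
  shows "cost V E (d t) x = local_cost V E (d t) v (x v) x +
    ((\<Sum>u\<in>V - {v}. fst (d t) u (x u)) + (\<Sum>e\<in>{e \<in> E. v \<notin> e}. edge_term (snd (d t)) x e))"
proof -
  have inj: "inj_on (\<lambda>u. {u, v}) (nbrs V E v)"
    by (auto simp: inj_on_def doubleton_eq_iff)
  have "(\<Sum>e\<in>{e \<in> E. v \<in> e}. edge_term (snd (d t)) x e)
      = (\<Sum>u\<in>nbrs V E v. edge_term (snd (d t)) x {u, v})"
    unfolding incident_edges[OF v] by (simp add: sum.reindex[OF inj])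
  also have "\<dots> = (\<Sum>u\<in>nbrs V E v. snd (d t) u v (x u) (x v))"
    by (intro sum.cong edge_term_doubleton) (auto simp: nbrs_def)
  finally have 1: "(\<Sum>e\<in>{e \<in> E. v \<in> e}. edge_term (snd (d t)) x e)
    = (\<Sum>u\<in>nbrs V E v. snd (d t) u v (x u) (x v))" .
  have "E = {e \<in> E. v \<in> e} \<union> {e \<in> E. v \<notin> e}" by auto
  then have "(\<Sum>e\<in>E. edge_term (snd (d t)) x e) = (\<Sum>e\<in>{e \<in> E. v \<in> e} \<union> {e \<in> E. v \<notin> e}. edge_term (snd (d t)) x e)"
    by simp
  also have "\<dots> = (\<Sum>e\<in>{e \<in> E. v \<in> e}. edge_term (snd (d t)) x e) + (\<Sum>e\<in>{e \<in> E. v \<notin> e}. edge_term (snd (d t)) x e)"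
    using finite_E by (intro sum.union_disjoint) auto
  finally show ?thesis
    using sum.remove[OF finite_V v, of "\<lambda>u. fst (d t) u (x u)"] 1
    by (simp add: cost_def local_cost_def)
qed

text \<open>The game is an exact potential game: a unilateral change of action moves the global cost
  exactly as it moves the local one. This is why purely local updates can sample from a global Gibbs
  measure.\<close>

lemma cost_upd:
  assumes v: "v \<in> V"
  shows "cost V E (d t) (x(v := a)) =
    local_cost V E (d t) v a x + (cost V E (d t) x - local_cost V E (d t) v (x v) x)"
proof -
  have "edge_term (snd (d t)) (x(v := a)) e = edge_term (snd (d t)) x e" if e: "e \<in> E" "v \<notin> e" for e
  proof -
    obtain u w where "e = {u, w}" using edge_doubleton[OF e(1)] by blast
    then show ?thesis using e by (auto simp: edge_term_doubleton)
  qed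
  then have "(\<Sum>e\<in>{e \<in> E. v \<notin> e}. edge_term (snd (d t)) (x(v := a)) e)
      = (\<Sum>e\<in>{e \<in> E. v \<notin> e}. edge_term (snd (d t)) x e)"
    by (intro sum.cong) auto
  moreover have "(\<Sum>u\<in>V - {v}. fst (d t) u ((x(v := a)) u)) = (\<Sum>u\<in>V - {v}. fst (d t) u (x u))"
    by (intro sum.cong) auto
  ultimately show ?thesis
    using cost_split[OF v, of t x] cost_split[OF v, of t "x(v := a)"]
    by (simp add: local_cost_upd)
qed


subsection \<open>Gibbs measures and the Glauber dynamics\<close>

text \<open>Dividing \<open>t\<close> costs by \<open>t + 1\<close> amounts to an additional round
  of cost zero, whose loss is the relative entropy alone; it acts as the regulariser in
  \<open>cumulative_loss\<close>.\<close>

definition avg_cost :: "nat \<Rightarrow> ('v \<Rightarrow> nat) \<Rightarrow> real" where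
  "avg_cost t x = 1 / (real t + 1) * (\<Sum>s=1..t. cost V E (d s) x)"

lemma avg_cost_upd:
  assumes "v \<in> V"
  shows "avg_cost t (x(v := a)) =
    avg_local_cost V E d t v a x + (avg_cost t x - avg_local_cost V E d t v (x v) x)"
proof -
  have "(\<Sum>s=1..t. cost V E (d s) (x(v := a)))
      = (\<Sum>s=1..t. local_cost V E (d s) v a x)
        + ((\<Sum>s=1..t. cost V E (d s) x) - (\<Sum>s=1..t. local_cost V E (d s) v (x v) x))"
    by (simp add: cost_upd[OF assms] sum.distrib sum_subtractf)
  then show ?thesis
    unfolding avg_cost_def avg_local_cost_def by (simp only: distrib_left right_diff_distrib)
qed

text \<open>The running average moves by a fraction \<open>1 / (t + 2)\<close> of the discrepancy
  between the new cost and the old average. This is the source of the \<open>O(1/t)\<close>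
  drift.\<close>

lemma avg_cost_Suc:
  "avg_cost (Suc t) x - avg_cost t x = (cost V E (d (Suc t)) x - avg_cost t x) / (real t + 2)"
proof -
  have 2: "real t + 2 > 0" "real t + 1 > 0" by auto
  show ?thesis
    unfolding avg_cost_def using 2
    by (simp add: divide_simps add.commute) (simp add: algebra_simps)
qed

lemma avg_cost_bound:
  assumes "x \<in> X"
  shows "\<bar>avg_cost t x\<bar> \<le> N * (\<Delta> + 1)"
proof -
  have "\<bar>\<Sum>s=1..t. cost V E (d s) x\<bar> \<le> (\<Sum>s=1..t. N * (\<Delta> + 1))"
    by (intro order_trans[OF sum_abs] sum_mono cost_bound assms)
  also have "\<dots> \<le> (real t + 1) * (N * (\<Delta> + 1))"
    by (simp add: mult_right_mono)
  finally show ?thesis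
    unfolding avg_cost_def by (simp add: abs_mult field_simps)
qed

definition weight :: "nat \<Rightarrow> ('v \<Rightarrow> nat) \<Rightarrow> real" where
  "weight t x = m x * exp (- \<beta> * avg_cost t x)"

text \<open>\<open>gibbs t\<close> is built from the first \<open>t\<close> costs, so it belongs to
  time \<open>t + 1\<close> and is compared with the law and the loss at
  \<open>Suc t\<close>.\<close>

definition gibbs :: "nat \<Rightarrow> ('v \<Rightarrow> nat) \<Rightarrow> real" where
  "gibbs t x = weight t x / sum (weight t) X"

lemma weight_pos: "x \<in> X \<Longrightarrow> weight t x > 0"
  by (simp add: weight_def m_pos)

lemma partition_pos: "sum (weight t) X > 0"
  using finite_X X_ne weight_pos by (intro sum_pos) auto

lemma gibbs_pos: "x \<in> X \<Longrightarrow> gibbs t x > 0"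
  by (simp add: gibbs_def weight_pos partition_pos)

lemma sum_gibbs: "sum (gibbs t) X = 1"
  unfolding gibbs_def sum_divide_distrib[symmetric] using partition_pos[of t] by simp

text \<open>The local rule is the conditional distribution of the Gibbs measure at \<open>v\<close>
  given all other coordinates.\<close>

lemma pmf_local_update_weight:
  assumes x: "x \<in> X" and v: "v \<in> V" and a: "a \<in> {1..q}"
  shows "pmf (local_update V E q \<beta> \<mu> d t v x) a = weight t (x(v := a)) / (\<Sum>b=1..q. weight t (x(v := b)))"
proof -
  \<comment> \<open>The part of the weight that does not depend on the resampled action; it cancels
    in the quotient.\<close>
  define c where "c = (\<Prod>u\<in>V - {v}. pmf (\<mu> u) (x u)) *
    exp (- \<beta> * (avg_cost t x - avg_local_cost V E d t v (x v) x))"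
  have "(\<Prod>u\<in>V - {v}. pmf (\<mu> u) (x u)) > 0"
    using x by (intro prod_pos) (auto intro!: mu_pos X_val simp del: atLeastAtMost_iff)
  then have c: "c > 0" by (simp add: c_def)
  have w: "weight t (x(v := b)) = c * (pmf (\<mu> v) b * exp (- \<beta> * avg_local_cost V E d t v b x))"
    if "b \<in> {1..q}" for b
    unfolding weight_def m_upd[OF x v that] avg_cost_upd[OF v] distrib_left exp_add c_def
    by (simp only: mult_ac)
  have "(\<Sum>b=1..q. weight t (x(v := b)))
      = c * (\<Sum>b=1..q. pmf (\<mu> v) b * exp (- \<beta> * avg_local_cost V E d t v b x))"
    unfolding sum_distrib_left by (intro sum.cong w) auto
  then show ?thesis
    using c a by (simp add: pmf_local_update[where \<mu> = \<mu> and v = v and q = q, OF q_pos mu_supp[OF v]] w)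
qed

text \<open>The conditional expectation of \<open>h\<close> given all coordinates but
  \<open>v\<close>. The dynamics is studied through operators on functions because the contraction
  is proved on the dual side.\<close>

definition resample :: "nat \<Rightarrow> 'v \<Rightarrow> (('v \<Rightarrow> nat) \<Rightarrow> real) \<Rightarrow> ('v \<Rightarrow> nat) \<Rightarrow> real" where
  "resample t v h x = (\<Sum>a=1..q. pmf (local_update V E q \<beta> \<mu> d t v x) a * h (x(v := a)))"

definition glauber_op :: "nat \<Rightarrow> (('v \<Rightarrow> nat) \<Rightarrow> real) \<Rightarrow> ('v \<Rightarrow> nat) \<Rightarrow> real" where
  "glauber_op t h x = (\<Sum>v\<in>V. resample t v h x) / N"

lemma set_local_update: "v \<in> V \<Longrightarrow> set_pmf (local_update V E q \<beta> \<mu> d t v x) \<subseteq> {1..q}"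
  by (auto simp: set_pmf_iff pmf_local_update[where \<mu> = \<mu> and v = v and q = q, OF q_pos mu_supp] split: if_splits)

text \<open>Detailed balance: \<open>weight t x\<close> times the probability of moving to
  \<open>x(v := a)\<close> is symmetric in the two profiles.\<close>

lemma gibbs_resample:
  assumes v: "v \<in> V"
  shows "(\<Sum>x\<in>X. gibbs t x * resample t v h x) = (\<Sum>x\<in>X. gibbs t x * h x)"
proof -
  define S where "S x = (\<Sum>b=1..q. weight t (x(v := b)))" for x
  have S: "S x > 0" if "x \<in> X" for x
    unfolding S_def using q_pos by (intro sum_pos weight_pos X_upd that v) auto
  have "(\<Sum>x\<in>X. weight t x * resample t v h x)
      = (\<Sum>x\<in>X. \<Sum>a\<in>{1..q}. weight t x * (weight t (x(v := a)) / S x * h (x(v := a))))"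
    unfolding resample_def sum_distrib_left S_def
    by (intro sum.cong refl) (simp add: pmf_local_update_weight v)
  also have "\<dots> = (\<Sum>(x, a)\<in>X \<times> {1..q}. weight t x * (weight t (x(v := a)) / S x * h (x(v := a))))"
    by (simp add: sum.cartesian_product)
  \<comment> \<open>The involution exchanges the old and the new action at \<open>v\<close>. It
    fixes the normaliser \<open>S\<close>, which ignores the coordinate \<open>v\<close>.\<close>
  also have "\<dots> = (\<Sum>(y, b)\<in>X \<times> {1..q}. weight t y * h y * (weight t (y(v := b)) / S y))"
    by (rule sum.reindex_bij_witness[where i = "\<lambda>(x, a). (x(v := a), x v)" and j = "\<lambda>(x, a). (x(v := a), x v)"])
      (auto intro!: X_upd[OF _ v] simp: S_def dest: X_val[OF _ v])
  also have "\<dots> = (\<Sum>y\<in>X. weight t y * h y * (\<Sum>b=1..q. weight t (y(v := b)) / S y))"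
    unfolding sum_distrib_left by (simp add: sum.cartesian_product)
  also have "\<dots> = (\<Sum>y\<in>X. weight t y * h y)"
  proof (intro sum.cong refl)
    fix y assume "y \<in> X"
    then have "(\<Sum>b=1..q. weight t (y(v := b)) / S y) = 1"
      using S[of y] by (simp add: sum_divide_distrib[symmetric] S_def)
    then show "weight t y * h y * (\<Sum>b=1..q. weight t (y(v := b)) / S y) = weight t y * h y" by simp
  qed
  finally show ?thesis
    unfolding gibbs_def by (simp add: sum_divide_distrib[symmetric])
qed

lemma gibbs_invariant: "(\<Sum>x\<in>X. gibbs t x * glauber_op t h x) = (\<Sum>x\<in>X. gibbs t x * h x)"
proof -
  have "(\<Sum>x\<in>X. gibbs t x * glauber_op t h x) = (\<Sum>x\<in>X. \<Sum>v\<in>V. gibbs t x * resample t v h x) / N"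
    unfolding glauber_op_def by (simp add: sum_divide_distrib sum_distrib_left)
  also have "\<dots> = (\<Sum>v\<in>V. \<Sum>x\<in>X. gibbs t x * resample t v h x) / N"
    by (subst sum.swap) simp
  also have "\<dots> = (\<Sum>x\<in>X. gibbs t x * h x)"
    using N_ge_1 by (simp add: gibbs_resample)
  finally show ?thesis .
qed

abbreviation "law t \<equiv> pmf (action_dist V E q \<beta> \<mu> d t)"

lemma expectation_glauber_kernel:
  "x \<in> X \<Longrightarrow> measure_pmf.expectation (glauber_kernel V E q \<beta> \<mu> d t x) h = glauber_op t h x"
proof -
  assume x: "x \<in> X"
  have fin: "finite (set_pmf (local_update V E q \<beta> \<mu> d t v x))" if "v \<in> V" for v
    using set_local_update[OF that] finite_subset by blast
  have "measure_pmf.expectation (glauber_kernel V E q \<beta> \<mu> d t x) h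
    = (\<Sum>v\<in>V. measure_pmf.expectation (map_pmf (\<lambda>a. x(v := a)) (local_update V E q \<beta> \<mu> d t v x)) h /\<^sub>R N)"
    unfolding glauber_kernel_def using finite_V V_ne fin
    by (intro pmf_expectation_bind_pmf_of_set) auto
  also have "\<dots> = (\<Sum>v\<in>V. resample t v h x / N)"
  proof (intro sum.cong refl)
    fix v assume v: "v \<in> V"
    have "measure_pmf.expectation (map_pmf (\<lambda>a. x(v := a)) (local_update V E q \<beta> \<mu> d t v x)) h
      = (\<Sum>a\<in>{1..q}. h (x(v := a)) * pmf (local_update V E q \<beta> \<mu> d t v x) a)"
      unfolding integral_map_pmf
      by (rule integral_measure_pmf_real) (use set_local_update[OF v, of t x] in blast)+
    then show "measure_pmf.expectation (map_pmf (\<lambda>a. x(v := a)) (local_update V E q \<beta> \<mu> d t v x)) h /\<^sub>R N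
      = resample t v h x / N"
      by (simp add: resample_def mult.commute divide_inverse)
  qed
  finally show ?thesis by (simp add: glauber_op_def sum_divide_distrib)
qed

lemma set_glauber_kernel:
  assumes "x \<in> X"
  shows "set_pmf (glauber_kernel V E q \<beta> \<mu> d t x) \<subseteq> X"
proof -
  have "x(v := a) \<in> X" if "v \<in> V" "a \<in> set_pmf (local_update V E q \<beta> \<mu> d t v x)" for v a
    using X_upd[OF assms that(1)] set_local_update[OF that(1)] that(2) by (meson subsetD)
  then show ?thesis using finite_V V_ne by (auto simp: glauber_kernel_def)
qed

lemma set_action_dist: "set_pmf (action_dist V E q \<beta> \<mu> d t) \<subseteq> X"
proof (induction t)
  case 0
  have "initial_dist V \<mu> \<in> distributions V q"
    using initial_dist_in_distributions[OF finite_V] mu_supp by metis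
  then show ?case by (simp add: distributions_def)
next
  case (Suc t)
  then show ?case using set_glauber_kernel by auto
qed

text \<open>One step of the chain is moved from the law to the test function.\<close>

lemma law_Suc: "(\<Sum>x\<in>X. law (Suc t) x * h x) = (\<Sum>x\<in>X. law t x * glauber_op t h x)"
proof -
  have "(\<Sum>x\<in>X. law (Suc t) x * h x) = measure_pmf.expectation (action_dist V E q \<beta> \<mu> d (Suc t)) h"
    using set_action_dist[of "Suc t"]
    by (subst integral_measure_pmf_real[OF finite_X]) (auto simp: mult.commute)
  also have "\<dots> = (\<Sum>x\<in>X. law t x *\<^sub>R measure_pmf.expectation (glauber_kernel V E q \<beta> \<mu> d t x) h)"
    unfolding action_dist.simps
  proof (rule pmf_expectation_bind[OF finite_X])
    show "finite (set_pmf (glauber_kernel V E q \<beta> \<mu> d t x))" if "x \<in> X" for x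
      using set_glauber_kernel[OF that] finite_X finite_subset by blast
  qed (rule set_action_dist)
  also have "\<dots> = (\<Sum>x\<in>X. law t x * glauber_op t h x)"
    by (simp add: expectation_glauber_kernel)
  finally show ?thesis .
qed

lemma sum_law: "sum (law t) X = 1"
  by (rule sum_pmf_eq_1[OF finite_X set_action_dist])


subsection \<open>Dobrushin contraction\<close>

text \<open>Lipschitz continuity with constant \<open>k\<close> for the Hamming metric, tested on
  changes of a single coordinate.\<close>

definition lip :: "real \<Rightarrow> (('v \<Rightarrow> nat) \<Rightarrow> real) \<Rightarrow> bool" where
  "lip k h \<longleftrightarrow> (\<forall>x\<in>X. \<forall>v\<in>V. \<forall>a\<in>{1..q}. \<bar>h (x(v := a)) - h x\<bar> \<le> k)"

lemma lipD: "lip k h \<Longrightarrow> x \<in> X \<Longrightarrow> v \<in> V \<Longrightarrow> a \<in> {1..q} \<Longrightarrow> \<bar>h (x(v := a)) - h x\<bar> \<le> k"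
  by (simp add: lip_def)

lemma lip_oscillation:
  assumes lip: "lip k h" and x: "x \<in> X" and y: "y \<in> X"
  shows "\<bar>h x - h y\<bar> \<le> N * k"
proof -
  \<comment> \<open>The profiles \<open>override_on x y S\<close> lead from \<open>x\<close> to
    \<open>y\<close> one coordinate at a time as \<open>S\<close> grows from the empty set to
    \<open>V\<close>.\<close>
  have *: "override_on x y S \<in> X \<and> \<bar>h (override_on x y S) - h x\<bar> \<le> real (card S) * k" if "S \<subseteq> V" for S
    using finite_subset[OF that finite_V] that
  proof (induction S rule: finite_induct)
    case (insert v S)
    have upd: "override_on x y (insert v S) = (override_on x y S)(v := y v)"
      by (auto simp: override_on_def)
    have z: "override_on x y S \<in> X" "v \<in> V" "y v \<in> {1..q}"
      using insert X_val[OF y] by (auto simp del: atLeastAtMost_iff)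
    have "real (card (insert v S)) * k = real (card S) * k + k"
      using insert by (simp add: algebra_simps)
    moreover have "\<bar>h (override_on x y S) - h x\<bar> \<le> real (card S) * k" using insert by simp
    ultimately have "\<bar>h (override_on x y (insert v S)) - h x\<bar> \<le> real (card (insert v S)) * k"
      unfolding upd using lipD[OF lip z] by linarith
    then show ?case using X_upd[OF z] by (simp only: upd)
  qed (use x in simp)
  have "override_on x y V = y"
    using x y by (auto simp: override_on_def profiles_def PiE_def extensional_def fun_eq_iff)
  then show ?thesis using *[of V] by (simp add: abs_minus_commute)
qed

lemma sum_local_update: "v \<in> V \<Longrightarrow> (\<Sum>a=1..q. pmf (local_update V E q \<beta> \<mu> d t v x) a) = 1"
  using set_local_update by (intro sum_pmf_eq_1) auto

text \<open>Only the pair term of the edge between \<open>u\<close> and \<open>v\<close> is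
  affected, and its values lie in \<open>[-1, 1]\<close>.\<close>

lemma avg_local_cost_neighbor_diff:
  assumes x: "x \<in> X" and v: "v \<in> V" and u: "u \<in> nbrs V E v" and c: "c \<in> {1..q}" and a: "a \<in> {1..q}"
  shows "\<bar>avg_local_cost V E d t v a (x(u := c)) - avg_local_cost V E d t v a x\<bar> \<le> 2"
proof -
  have e: "{u, v} \<in> E" and uV: "u \<in> V" using u by (auto simp: nbrs_def)
  have "local_cost V E (d s) v a (x(u := c)) - local_cost V E (d s) v a x
      = snd (d s) u v c a - snd (d s) u v (x u) a" for s
  proof -
    have "(\<Sum>w\<in>nbrs V E v - {u}. snd (d s) w v ((x(u := c)) w) a)
        = (\<Sum>w\<in>nbrs V E v - {u}. snd (d s) w v (x w) a)"
      by (intro sum.cong) auto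
    then show ?thesis
      unfolding local_cost_def
      using sum.remove[OF finite_nbrs u, of "\<lambda>w. snd (d s) w v ((x(u := c)) w) a"]
        sum.remove[OF finite_nbrs u, of "\<lambda>w. snd (d s) w v (x w) a"] by simp
  qed
  then have "\<bar>local_cost V E (d s) v a (x(u := c)) - local_cost V E (d s) v a x\<bar> \<le> 2" for s
    using psi_le[OF e c a, of s] psi_le[OF e X_val[OF x uV] a, of s] by simp
  then have "\<bar>\<Sum>s=1..t. local_cost V E (d s) v a (x(u := c)) - local_cost V E (d s) v a x\<bar> \<le> (\<Sum>s=1..t. 2)"
    by (intro order_trans[OF sum_abs] sum_mono)
  then have "\<bar>(\<Sum>s=1..t. local_cost V E (d s) v a (x(u := c))) - (\<Sum>s=1..t. local_cost V E (d s) v a x)\<bar>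
      \<le> 2 * (real t + 1)"
    by (simp add: sum_subtractf)
  moreover have "avg_local_cost V E d t v a (x(u := c)) - avg_local_cost V E d t v a x
    = ((\<Sum>s=1..t. local_cost V E (d s) v a (x(u := c))) - (\<Sum>s=1..t. local_cost V E (d s) v a x)) / (real t + 1)"
    unfolding avg_local_cost_def by (simp add: diff_divide_distrib)
  ultimately show ?thesis by (simp add: abs_divide divide_le_eq)
qed

lemma local_update_cong:
  assumes "\<And>a s. local_cost V E (d s) v a x = local_cost V E (d s) v a x'"
  shows "local_update V E q \<beta> \<mu> d t v x = local_update V E q \<beta> \<mu> d t v x'"
  unfolding local_update_def avg_local_cost_def assms ..

text \<open>If \<open>u = v\<close>, the resampling overwrites the change. Otherwise the change
  persists in the argument of \<open>h\<close>, which costs \<open>k\<close>, and it alters the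
  update rule only if \<open>u\<close> is a neighbour of \<open>v\<close>. Then the exponents move
  by at most 2\<beta>, the rule moves by at most \<beta> in total variation, and \<open>h\<close>
  varies by at most \<open>k\<close> over the actions at \<open>v\<close>.\<close>

lemma resample_diff:
  assumes lip: "lip k h" and x: "x \<in> X" and v: "v \<in> V" and u: "u \<in> V" and c: "c \<in> {1..q}"
  shows "\<bar>resample t v h (x(u := c)) - resample t v h x\<bar>
    \<le> (if u = v then 0 else k) + (if u \<in> nbrs V E v then \<beta> * k else 0)"
proof (cases "u = v")
  case True
  have "local_update V E q \<beta> \<mu> d t v (x(u := c)) = local_update V E q \<beta> \<mu> d t v x"
    unfolding True by (intro local_update_cong local_cost_upd)
  then have "resample t v h (x(u := c)) = resample t v h x"
    unfolding resample_def True by simp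
  then show ?thesis using True nbrs_irrefl by simp
next
  case False
  let ?p = "\<lambda>x a. pmf (local_update V E q \<beta> \<mu> d t v x) a"
  let ?x' = "x(u := c)"
  have comm: "?x'(v := a) = (x(v := a))(u := c)" for a using False by (simp add: fun_upd_twist)
  have "\<bar>\<Sum>a=1..q. ?p ?x' a * (h (?x'(v := a)) - h (x(v := a)))\<bar> \<le> (\<Sum>a=1..q. ?p ?x' a * k)"
  proof (intro order_trans[OF sum_abs] sum_mono)
    fix a assume "a \<in> {1..q}"
    then show "\<bar>?p ?x' a * (h (?x'(v := a)) - h (x(v := a)))\<bar> \<le> ?p ?x' a * k"
      unfolding comm abs_mult using lipD[OF lip X_upd[OF x v] u c] by (simp add: mult_left_mono)
  qed
  also have "\<dots> = k" unfolding sum_distrib_right[symmetric] sum_local_update[OF v] by simp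
  finally have 1: "\<bar>\<Sum>a=1..q. ?p ?x' a * (h (?x'(v := a)) - h (x(v := a)))\<bar> \<le> k" .
  have 2: "\<bar>\<Sum>a=1..q. (?p x a - ?p ?x' a) * h (x(v := a))\<bar> \<le> (if u \<in> nbrs V E v then \<beta> * k else 0)"
  proof (cases "u \<in> nbrs V E v")
    case False
    have "local_update V E q \<beta> \<mu> d t v ?x' = local_update V E q \<beta> \<mu> d t v x"
      by (rule local_update_cong) (use False in \<open>auto simp: local_cost_def intro!: sum.cong\<close>)
    then show ?thesis using False by simp
  next
    case True
    let ?w = "\<lambda>x a. pmf (\<mu> v) a * exp (- (\<beta> * avg_local_cost V E d t v a x))"
    have p: "?p y a = ?w y a / sum (?w y) {1..q}" if "a \<in> {1..q}" for y a
      using that by (simp add: pmf_local_update[where \<mu> = \<mu> and v = v and q = q, OF q_pos mu_supp[OF v]])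
    have close: "\<bar>\<beta> * avg_local_cost V E d t v a ?x' - \<beta> * avg_local_cost V E d t v a x\<bar> \<le> 2 * \<beta>"
      if "a \<in> {1..q}" for a
      using mult_left_mono[OF avg_local_cost_neighbor_diff[OF x v True c that, of t], of \<beta>] beta_pos
      by (simp add: abs_mult right_diff_distrib[symmetric])
    have "\<bar>\<Sum>a=1..q. (?w x a / sum (?w x) {1..q} - ?w ?x' a / sum (?w ?x') {1..q}) * h (x(v := a))\<bar> \<le> 2 * \<beta> / 2 * k"
    proof (rule normalized_sum_diff_le)
      show "h (x(v := a)) - h (x(v := b)) \<le> k" if "a \<in> {1..q}" "b \<in> {1..q}" for a b
        using lipD[OF lip X_upd[OF x v that(2)] v that(1)] by simp
    qed (use q_pos mu_pos[OF v] exp_mult_bounds[OF close mu_pos[OF v]] in auto)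
    also have "(\<Sum>a=1..q. (?w x a / sum (?w x) {1..q} - ?w ?x' a / sum (?w ?x') {1..q}) * h (x(v := a)))
      = (\<Sum>a=1..q. (?p x a - ?p ?x' a) * h (x(v := a)))"
      by (intro sum.cong refl) (simp only: p)
    finally show ?thesis using True by simp
  qed
  have "resample t v h ?x' - resample t v h x = (\<Sum>a=1..q. ?p ?x' a * (h (?x'(v := a)) - h (x(v := a))))
      - (\<Sum>a=1..q. (?p x a - ?p ?x' a) * h (x(v := a)))"
    unfolding resample_def sum_subtractf[symmetric] by (intro sum.cong) (auto simp: algebra_simps)
  then show ?thesis using 1 2 False by simp
qed

definition contraction :: real where
  "contraction = 1 - (1 - \<Delta> * \<beta>) / N"

lemma contraction_nonneg: "contraction \<ge> 0"
proof -
  have "1 - \<Delta> * \<beta> \<le> N" using N_ge_1 beta_pos by (smt (verit) mult_nonneg_nonneg of_nat_0_le_iff)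
  then show ?thesis using N_ge_1 by (simp add: contraction_def)
qed

text \<open>Average \<open>resample_diff\<close> over the activated vertex: \<open>v = u\<close>
  saves one \<open>k\<close>, and at most \<Delta> neighbours add \<beta>\<open>k\<close> each,
  which gives \<open>(N - 1 + \<Delta> * \<beta>) * k / N\<close>.\<close>

lemma lip_glauber_op:
  assumes lip: "lip k h"
  shows "lip (contraction * k) (glauber_op t h)"
  unfolding lip_def
proof (intro ballI)
  fix x u c assume x: "x \<in> X" and u: "u \<in> V" and c: "c \<in> {1..q}"
  have k: "k \<ge> 0" using lipD[OF lip x u c] by linarith
  have "glauber_op t h (x(u := c)) - glauber_op t h x
      = (\<Sum>v\<in>V. resample t v h (x(u := c)) - resample t v h x) / N"
    unfolding glauber_op_def by (simp add: sum_subtractf diff_divide_distrib)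
  also have "\<bar>\<dots>\<bar> \<le> (\<Sum>v\<in>V. (if u = v then 0 else k) + (if u \<in> nbrs V E v then \<beta> * k else 0)) / N"
    unfolding abs_divide using N_ge_1
    by (auto intro!: divide_right_mono order_trans[OF sum_abs] sum_mono resample_diff[OF lip x _ u c])
  also have "(\<Sum>v\<in>V. (if u = v then 0 else k) + (if u \<in> nbrs V E v then \<beta> * k else 0))
      = (\<Sum>v\<in>V. k - (if v = u then k else 0)) + (\<Sum>v\<in>{v \<in> V. u \<in> nbrs V E v}. \<beta> * k)"
    unfolding sum.distrib sum.inter_filter[OF finite_V]
    by (intro arg_cong2[where f = "(+)"] sum.cong) auto
  also have "{v \<in> V. u \<in> nbrs V E v} = nbrs V E u"
    using nbrs_sym[OF u] by (auto simp: nbrs_def)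
  also have "(\<Sum>v\<in>V. k - (if v = u then k else 0)) = N * k - k"
    using finite_V u by (simp add: sum_subtractf)
  also have "(\<Sum>v\<in>nbrs V E u. \<beta> * k) \<le> \<Delta> * (\<beta> * k)"
    using card_nbrs_le[OF u] k beta_pos by (simp add: mult_right_mono)
  also have "(N * k - k + \<Delta> * (\<beta> * k)) / N = contraction * k"
    using N_ge_1 unfolding contraction_def by (simp add: field_simps)
  finally show "\<bar>glauber_op t h (x(u := c)) - glauber_op t h x\<bar> \<le> contraction * k"
    using N_ge_1 by (simp add: divide_right_mono del: fun_upd_apply)
qed

section \<open>Drift of the Gibbs measures and their tracking by the dynamics\<close>

text \<open>The Kantorovich dual form of the Wasserstein distance for the Hamming metric.\<close>

definition wasserstein_le :: "(('v \<Rightarrow> nat) \<Rightarrow> real) \<Rightarrow> (('v \<Rightarrow> nat) \<Rightarrow> real) \<Rightarrow> real \<Rightarrow> bool" where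
  "wasserstein_le p p' c \<longleftrightarrow> (\<forall>k h. lip k h \<longrightarrow> (\<Sum>x\<in>X. (p x - p' x) * h x) \<le> c * k)"

text \<open>A uniform bound for the change of the exponent \<open>\<beta> * avg_cost\<close> from
  \<open>t\<close> to \<open>t + 1\<close>.\<close>

definition tilt :: "nat \<Rightarrow> real" where
  "tilt t = 2 * \<beta> * (N * (\<Delta> + 1)) / (real t + 2)"

lemma avg_cost_Suc_bound:
  assumes "x \<in> X"
  shows "\<bar>\<beta> * avg_cost (Suc t) x - \<beta> * avg_cost t x\<bar> \<le> tilt t"
proof -
  have "\<bar>cost V E (d (Suc t)) x - avg_cost t x\<bar> \<le> 2 * (N * (\<Delta> + 1))"
    using cost_bound[OF assms, of "Suc t"] avg_cost_bound[OF assms, of t] by linarith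
  then have "\<beta> * \<bar>cost V E (d (Suc t)) x - avg_cost t x\<bar> \<le> \<beta> * (2 * (N * (\<Delta> + 1)))"
    using beta_pos by (intro mult_left_mono) auto
  then show ?thesis
    unfolding right_diff_distrib[symmetric] avg_cost_Suc tilt_def
    using beta_pos by (simp add: abs_mult abs_divide divide_right_mono mult_ac)
qed

text \<open>The test function enters through its oscillation only, so the bound serves both for
  Lipschitz functions and for the log-density ratio in \<open>kl_gibbs_Suc\<close>.\<close>

lemma gibbs_Suc_diff:
  assumes "\<And>x y. x \<in> X \<Longrightarrow> y \<in> X \<Longrightarrow> h x - h y \<le> r"
  shows "\<bar>\<Sum>x\<in>X. (gibbs t x - gibbs (Suc t) x) * h x\<bar> \<le> tilt t / 2 * r"
  unfolding gibbs_def
proof (rule normalized_sum_diff_le[OF finite_X X_ne _ _ _ assms])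
  fix x assume x: "x \<in> X"
  show "exp (- tilt t) * weight t x \<le> weight (Suc t) x" "weight (Suc t) x \<le> exp (tilt t) * weight t x"
    unfolding weight_def using exp_mult_bounds[OF avg_cost_Suc_bound[OF x] m_pos[OF x], of t] by simp_all
qed (simp_all add: weight_pos)

lemma wasserstein_gibbs_Suc: "wasserstein_le (gibbs t) (gibbs (Suc t)) (tilt t / 2 * N)"
  unfolding wasserstein_le_def
proof (intro allI impI)
  fix k h assume "lip k h"
  then have "\<And>x y. x \<in> X \<Longrightarrow> y \<in> X \<Longrightarrow> h x - h y \<le> N * k"
    using lip_oscillation by (meson abs_le_D1)
  from gibbs_Suc_diff[OF this]
  have "(\<Sum>x\<in>X. (gibbs t x - gibbs (Suc t) x) * h x) \<le> tilt t / 2 * (N * k)"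
    by (rule abs_le_D1)
  then show "(\<Sum>x\<in>X. (gibbs t x - gibbs (Suc t) x) * h x) \<le> tilt t / 2 * N * k" by simp
qed

text \<open>The start is 0 because \<open>gibbs 0\<close> is the initial distribution and is
  invariant under the first kernel. In each step the drift is added before the contraction, since
  the target moves before the new kernel acts.\<close>

primrec wbound :: "nat \<Rightarrow> real" where
  "wbound 0 = 0"
| "wbound (Suc t) = contraction * (wbound t + tilt t / 2 * N)"

lemma gibbs_0: "x \<in> X \<Longrightarrow> gibbs 0 x = m x"
  using sum_law[of 0] by (simp add: gibbs_def weight_def avg_cost_def)

lemma wasserstein_law_gibbs: "wasserstein_le (law (Suc t)) (gibbs t) (wbound t)"
proof (induction t)
  case 0
  have "(\<Sum>x\<in>X. (law (Suc 0) x - gibbs 0 x) * h x) = 0" for h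
  proof -
    have "(\<Sum>x\<in>X. law (Suc 0) x * h x) = (\<Sum>x\<in>X. gibbs 0 x * glauber_op 0 h x)"
      unfolding law_Suc by (intro sum.cong) (simp_all add: gibbs_0)
    then show ?thesis by (simp add: gibbs_invariant left_diff_distrib sum_subtractf)
  qed
  then show ?case by (simp add: wasserstein_le_def)
next
  case (Suc t)
  show ?case
    unfolding wasserstein_le_def
  proof (intro allI impI)
    fix k h assume "lip k h"
    then have lip: "lip (contraction * k) (glauber_op (Suc t) h)" by (rule lip_glauber_op)
    let ?h = "glauber_op (Suc t) h"
    \<comment> \<open>Both the law and the invariant measure pass through the new kernel, so
      \<open>h\<close> can be replaced by its smoother image; the triangle inequality through
      \<open>gibbs t\<close> follows.\<close>
    have "(\<Sum>x\<in>X. (law (Suc (Suc t)) x - gibbs (Suc t) x) * h x)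
        = (\<Sum>x\<in>X. (law (Suc t) x - gibbs (Suc t) x) * ?h x)"
      by (simp only: left_diff_distrib sum_subtractf law_Suc[of "Suc t"] gibbs_invariant)
    also have "\<dots> = (\<Sum>x\<in>X. (law (Suc t) x - gibbs t x) * ?h x) + (\<Sum>x\<in>X. (gibbs t x - gibbs (Suc t) x) * ?h x)"
      by (simp add: left_diff_distrib sum_subtractf)
    also have "\<dots> \<le> wbound t * (contraction * k) + tilt t / 2 * N * (contraction * k)"
      using Suc wasserstein_gibbs_Suc lip unfolding wasserstein_le_def by (intro add_mono) blast+
    finally show "(\<Sum>x\<in>X. (law (Suc (Suc t)) x - gibbs (Suc t) x) * h x) \<le> wbound (Suc t) * k"
      by (simp add: algebra_simps)
  qed
qed

text \<open>The indicator of the set where the law exceeds the Gibbs measure is 1-Lipschitz for the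
  Hamming metric, so the total variation is dominated by the Wasserstein distance.\<close>

lemma excess_law_gibbs: "excess X (law (Suc t)) (gibbs t) \<le> wbound t"
proof -
  let ?h = "\<lambda>x. of_bool (law (Suc t) x > gibbs t x) :: real"
  have "lip 1 ?h" by (simp add: lip_def)
  then have "(\<Sum>x\<in>X. (law (Suc t) x - gibbs t x) * ?h x) \<le> wbound t * 1"
    using wasserstein_law_gibbs[of t] unfolding wasserstein_le_def by blast
  also have "(\<Sum>x\<in>X. (law (Suc t) x - gibbs t x) * ?h x) = excess X (law (Suc t)) (gibbs t)"
    unfolding excess_def sum.inter_filter[OF finite_X] by (intro sum.cong) auto
  finally show ?thesis by simp
qed

lemma sum_wbound: "(\<Sum>t<T. wbound t) \<le> N / (1 - \<Delta> * \<beta>) * (\<beta> * N^2 * (\<Delta> + 1)) * ln (real T + 1)"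
proof -
  let ?c = "\<beta> * N^2 * (\<Delta> + 1)"
  have c: "?c \<ge> 0" using beta_pos by simp
  have half: "tilt t / 2 * N = ?c * (1 / (real t + 2))" for t
    by (simp add: tilt_def power2_eq_square field_simps)
  have gap: "1 - contraction = (1 - \<Delta> * \<beta>) / N" by (simp add: contraction_def)
  have gap_pos: "(1 - \<Delta> * \<beta>) / N > 0" using subcritical N_ge_1 by (intro divide_pos_pos) linarith+
  have le1: "contraction \<le> 1" using gap gap_pos by linarith
  have nonneg: "wbound t \<ge> 0" for t
  proof (induction t)
    case (Suc t)
    have "tilt t / 2 * N \<ge> 0" unfolding half using c by simp
    then show ?case using Suc contraction_nonneg by simp
  qed simp
  \<comment> \<open>The recursion summed over time. The boundary term \<open>wbound T\<close> is
    kept on the left to close the induction and is dropped afterwards as nonnegative.\<close>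
  have "(1 - contraction) * (\<Sum>t<T. wbound t) + wbound T \<le> ?c * (\<Sum>t<T. 1 / (real t + 2))"
  proof (induction T)
    case (Suc T)
    have "contraction * (?c * (1 / (real T + 2))) \<le> 1 * (?c * (1 / (real T + 2)))"
      using le1 c by (intro mult_right_mono) auto
    then have "wbound (Suc T) \<le> contraction * wbound T + ?c * (1 / (real T + 2))"
      unfolding wbound.simps half distrib_left by linarith
    moreover have "(1 - contraction) * (\<Sum>t<Suc T. wbound t)
        = (1 - contraction) * (\<Sum>t<T. wbound t) + wbound T - contraction * wbound T"
      by (simp add: algebra_simps)
    moreover have "?c * (\<Sum>t<Suc T. 1 / (real t + 2))
        = ?c * (\<Sum>t<T. 1 / (real t + 2)) + ?c * (1 / (real T + 2))"
      unfolding sum.lessThan_Suc by (rule distrib_left)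
    ultimately show ?case using Suc by linarith
  qed simp
  also have "\<dots> \<le> ?c * ln (real T + 1)"
    using c harmonic_le_ln by (intro mult_left_mono) auto
  finally have "(1 - \<Delta> * \<beta>) / N * (\<Sum>t<T. wbound t) \<le> ?c * ln (real T + 1)"
    unfolding gap using nonneg[of T] by linarith
  then have "(\<Sum>t<T. wbound t) \<le> ?c * ln (real T + 1) / ((1 - \<Delta> * \<beta>) / N)"
    using gap_pos by (subst pos_le_divide_eq) (auto simp: mult.commute)
  then show ?thesis by (simp add: mult_ac)
qed


subsection \<open>Regret\<close>

definition loss :: "nat \<Rightarrow> (('v \<Rightarrow> nat) \<Rightarrow> real) \<Rightarrow> real" where
  "loss t p = \<beta> * (\<Sum>x\<in>X. p x * cost V E (d t) x) + kl X p m"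

lemma inst_loss_eq: "inst_loss V E q \<beta> \<mu> (d t) \<nu> = loss t (pmf \<nu>)"
  by (simp add: inst_loss_def rel_entropy_def kl_def loss_def)

abbreviation "log_partition t \<equiv> ln (sum (weight t) X)"

text \<open>The Gibbs variational identity: \<open>gibbs t\<close> is an exponential tilt of the
  prior, so the log-density ratios differ by the exponent and the log-partition function.\<close>

lemma kl_prior:
  assumes p: "\<And>x. x \<in> X \<Longrightarrow> p x \<ge> 0" "sum p X = 1"
  shows "kl X p m = kl X p (gibbs t) - \<beta> * (\<Sum>x\<in>X. p x * avg_cost t x) - log_partition t"
proof -
  have "p x * ln (p x / m x) = p x * ln (p x / gibbs t x) - \<beta> * (p x * avg_cost t x) - p x * log_partition t"
    if x: "x \<in> X" for x
  proof (cases "p x = 0")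
    case False
    then have "p x > 0" using p(1)[OF x] by simp
    then have ln_eq: "ln (p x / m x) = ln (p x / gibbs t x) - \<beta> * avg_cost t x - log_partition t"
      using m_pos[OF x] partition_pos[of t] weight_pos[OF x, of t]
      unfolding gibbs_def by (simp add: ln_div) (simp add: weight_def ln_mult)
    show ?thesis unfolding ln_eq by (simp add: algebra_simps)
  qed simp
  then have "kl X p m = (\<Sum>x\<in>X. p x * ln (p x / gibbs t x) - \<beta> * (p x * avg_cost t x) - p x * log_partition t)"
    unfolding kl_def by (intro sum.cong) auto
  also have "\<dots> = kl X p (gibbs t) - \<beta> * (\<Sum>x\<in>X. p x * avg_cost t x) - sum p X * log_partition t"
    by (simp add: kl_def sum_subtractf sum_distrib_left sum_distrib_right)
  finally show ?thesis using p(2) by simp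
qed

text \<open>The Gibbs measures follow the regularised leader: \<^term>\<open>gibbs t\<close> minimises the
  cumulative loss up to time \<open>t\<close> with the additional summand \<^term>\<open>kl X p m\<close>.\<close>

lemma cumulative_loss:
  assumes p: "\<And>x. x \<in> X \<Longrightarrow> p x \<ge> 0" "sum p X = 1"
  shows "(\<Sum>s=1..t. loss s p) + kl X p m = (real t + 1) * (kl X p (gibbs t) - log_partition t)"
proof -
  have "(\<Sum>s=1..t. \<Sum>x\<in>X. p x * cost V E (d s) x) = (\<Sum>x\<in>X. p x * (\<Sum>s=1..t. cost V E (d s) x))"
    unfolding sum_distrib_left by (rule sum.swap)
  also have "\<dots> = (\<Sum>x\<in>X. (real t + 1) * (p x * avg_cost t x))"
    by (intro sum.cong) (simp_all add: avg_cost_def)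
  finally have "(\<Sum>s=1..t. \<Sum>x\<in>X. p x * cost V E (d s) x) = (real t + 1) * (\<Sum>x\<in>X. p x * avg_cost t x)"
    by (simp only: sum_distrib_left)
  then have "(\<Sum>s=1..t. loss s p) = \<beta> * ((real t + 1) * (\<Sum>x\<in>X. p x * avg_cost t x)) + real t * kl X p m"
    unfolding loss_def sum.distrib sum_distrib_left[symmetric] by simp
  then show ?thesis
    using kl_prior[OF p, of t] by (simp add: algebra_simps)
qed

lemma kl_self: "kl X p p = 0"
  unfolding kl_def by (intro sum.neutral) auto

text \<open>Subtract \<open>cumulative_loss\<close> at \<open>t\<close> from the one at
  \<open>Suc t\<close>, both for \<open>gibbs t\<close>. Up to the divergence of consecutive Gibbs
  measures, the loss is an increment of \<open>- (t + 1) * log_partition t\<close>.\<close>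

lemma loss_gibbs:
  "loss (Suc t) (gibbs t) = (real t + 2) * (kl X (gibbs t) (gibbs (Suc t)) - log_partition (Suc t))
     + (real t + 1) * log_partition t"
proof -
  have g: "\<And>x. x \<in> X \<Longrightarrow> gibbs t x \<ge> 0" using gibbs_pos less_imp_le by blast
  show ?thesis
    using cumulative_loss[OF g sum_gibbs, of t] cumulative_loss[OF g sum_gibbs, of "Suc t"]
    by (simp add: kl_self algebra_simps)
qed

text \<open>Adding the reverse divergence, which is nonnegative, cancels the log-partition
  functions. What remains pairs the difference of the measures, of total variation at most
  \<open>tilt t / 2\<close>, with a function of oscillation at most \<open>2 * tilt t\<close>. The
  result is quadratic in the drift.\<close>

lemma kl_gibbs_Suc: "kl X (gibbs t) (gibbs (Suc t)) \<le> (tilt t)\<^sup>2"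
proof -
  define h where "h x = \<beta> * avg_cost (Suc t) x - \<beta> * avg_cost t x" for x
  define c where "c = log_partition (Suc t) - log_partition t"
  have ratio: "ln (gibbs t x / gibbs (Suc t) x) = h x + c" "ln (gibbs (Suc t) x / gibbs t x) = - h x - c"
    if x: "x \<in> X" for x
  proof -
    have "ln (gibbs s x) = ln (m x) - \<beta> * avg_cost s x - log_partition s" for s
      using m_pos[OF x] partition_pos[of s] weight_pos[OF x, of s]
      unfolding gibbs_def by (simp add: ln_div) (simp add: weight_def ln_mult)
    moreover have "gibbs s x \<noteq> 0" for s using gibbs_pos[OF x, of s] by simp
    ultimately show "ln (gibbs t x / gibbs (Suc t) x) = h x + c" "ln (gibbs (Suc t) x / gibbs t x) = - h x - c"
      by (simp_all add: ln_div h_def c_def)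
  qed
  have "kl X (gibbs t) (gibbs (Suc t)) = (\<Sum>x\<in>X. gibbs t x * (h x + c))"
    unfolding kl_def by (intro sum.cong) (simp_all add: ratio)
  moreover have "kl X (gibbs (Suc t)) (gibbs t) = (\<Sum>x\<in>X. gibbs (Suc t) x * (- h x - c))"
    unfolding kl_def by (intro sum.cong) (simp_all add: ratio)
  moreover have "kl X (gibbs (Suc t)) (gibbs t) \<ge> 0"
    by (intro kl_nonneg) (simp_all add: gibbs_pos less_imp_le sum_gibbs)
  ultimately have "kl X (gibbs t) (gibbs (Suc t))
      \<le> (\<Sum>x\<in>X. gibbs t x * (h x + c)) + (\<Sum>x\<in>X. gibbs (Suc t) x * (- h x - c))"
    by linarith
  also have "\<dots> = (\<Sum>x\<in>X. (gibbs t x - gibbs (Suc t) x) * h x) + c * (sum (gibbs t) X - sum (gibbs (Suc t)) X)"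
    unfolding sum.distrib[symmetric] sum_subtractf[symmetric] sum_distrib_left
    by (intro sum.cong) (auto simp: algebra_simps)
  also have "\<dots> = (\<Sum>x\<in>X. (gibbs t x - gibbs (Suc t) x) * h x)" by (simp add: sum_gibbs)
  also have "\<dots> \<le> tilt t / 2 * (2 * tilt t)"
  proof (rule abs_le_D1, rule gibbs_Suc_diff)
    fix x y assume "x \<in> X" "y \<in> X"
    then have "\<bar>h x\<bar> \<le> tilt t" "\<bar>h y\<bar> \<le> tilt t"
      unfolding h_def by (simp_all only: avg_cost_Suc_bound)
    then show "h x - h y \<le> 2 * tilt t" by linarith
  qed
  also have "\<dots> = (tilt t)\<^sup>2" by (simp add: power2_eq_square)
  finally show ?thesis .
qed

lemma log_partition_0: "log_partition 0 = 0"
  using sum_law[of 0] by (simp add: weight_def avg_cost_def)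

text \<open>The log-partition terms of \<open>loss_gibbs\<close> telescope, and
  \<open>(t + 2) * (tilt t)^2\<close> is of order \<open>1 / (t + 2)\<close>.\<close>

lemma sum_loss_gibbs:
  "(\<Sum>t<T. loss (Suc t) (gibbs t))
    \<le> - (real T + 1) * log_partition T + 4 * (\<beta> * (N * (\<Delta> + 1)))\<^sup>2 * (\<Sum>t<T. 1 / (real t + 2))"
proof (induction T)
  case (Suc T)
  let ?c = "4 * (\<beta> * (N * (\<Delta> + 1)))\<^sup>2"
  have sq: "y * (2 * \<beta> * z / y)\<^sup>2 = 4 * (\<beta> * z)\<^sup>2 * (1 / y)" if "y \<noteq> 0" for y z :: real
    using that by (simp add: power2_eq_square)
  have "(real T + 2) * kl X (gibbs T) (gibbs (Suc T)) \<le> (real T + 2) * (tilt T)\<^sup>2"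
    by (intro mult_left_mono kl_gibbs_Suc) simp
  also have "\<dots> = ?c * (1 / (real T + 2))"
    unfolding tilt_def by (rule sq) simp
  finally have "loss (Suc T) (gibbs T)
      \<le> ?c * (1 / (real T + 2)) - (real T + 2) * log_partition (Suc T) + (real T + 1) * log_partition T"
    unfolding loss_gibbs right_diff_distrib by linarith
  moreover have "?c * (\<Sum>t<Suc T. 1 / (real t + 2)) = ?c * (\<Sum>t<T. 1 / (real t + 2)) + ?c * (1 / (real T + 2))"
    unfolding sum.lessThan_Suc by (rule distrib_left)
  moreover have "- (real (Suc T) + 1) * log_partition (Suc T) = - ((real T + 2) * log_partition (Suc T))"
    by (simp add: algebra_simps)
  moreover have "- (real T + 1) * log_partition T = - ((real T + 1) * log_partition T)" by (rule mult_minus_left)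
  ultimately show ?case using Suc unfolding sum.lessThan_Suc[of "\<lambda>t. loss (Suc t) (gibbs t)"] by linarith
qed (simp add: log_partition_0)

section \<open>Lower bounds for the prior and the Gibbs measures\<close>

definition min_local :: real where
  "min_local = (MIN v\<in>V. MIN a\<in>{1..q}. pmf (\<mu> v) a)"

definition min_prior :: real where
  "min_prior = (MIN x\<in>X. m x)"

lemma min_prior: "min_prior > 0" "x \<in> X \<Longrightarrow> min_prior \<le> m x" "min_prior \<le> 1"
proof -
  show le: "min_prior \<le> m x" if "x \<in> X" for x
    unfolding min_prior_def using finite_X that by simp
  have "min_prior \<in> m ` X" unfolding min_prior_def using finite_X X_ne by (intro Min_in) auto
  then show "min_prior > 0" "min_prior \<le> 1" using m_pos by (auto simp: pmf_le_1)
qed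

lemma min_local: "min_local > 0" "v \<in> V \<Longrightarrow> a \<in> {1..q} \<Longrightarrow> min_local \<le> pmf (\<mu> v) a" "min_local \<le> 1"
proof -
  have ne: "{1..q} \<noteq> {}" using q_pos by simp
  have inner: "(MIN a\<in>{1..q}. pmf (\<mu> v) a) \<in> pmf (\<mu> v) ` {1..q}" for v
    using ne by (intro Min_in) auto
  have outer: "min_local \<in> (\<lambda>v. MIN a\<in>{1..q}. pmf (\<mu> v) a) ` V"
    unfolding min_local_def using finite_V V_ne by (intro Min_in) auto
  then obtain v where v: "v \<in> V" "min_local = (MIN a\<in>{1..q}. pmf (\<mu> v) a)" by blast
  obtain a where a: "a \<in> {1..q}" "min_local = pmf (\<mu> v) a" using inner[of v] v by auto
  show "min_local > 0" "min_local \<le> 1" using mu_pos[OF v(1) a(1)] a by (auto simp: pmf_le_1)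
  show "min_local \<le> pmf (\<mu> v) a" if "v \<in> V" "a \<in> {1..q}" for v a
  proof -
    have "min_local \<le> (MIN a\<in>{1..q}. pmf (\<mu> v) a)"
      unfolding min_local_def using finite_V that by (intro Min_le) auto
    also have "\<dots> \<le> pmf (\<mu> v) a" using that by (intro Min_le) auto
    finally show ?thesis .
  qed
qed

lemma m_ge: "x \<in> X \<Longrightarrow> min_local ^ card V \<le> m x"
proof -
  assume x: "x \<in> X"
  have "(\<Prod>v\<in>V. min_local) \<le> (\<Prod>v\<in>V. pmf (\<mu> v) (x v))"
    using min_local(1) min_local(2)[OF _ X_val[OF x]] by (intro prod_mono) auto
  then show ?thesis by (simp add: m_eq[OF x])
qed

text \<open>The prior has mass at least \<open>min_local ^ card V\<close> at each profile; the
  exponent and the log-partition function cost \<open>\<beta> * (N * (\<Delta> + 1))\<close>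
  each.\<close>

lemma ln_inverse_gibbs:
  assumes x: "x \<in> X"
  shows "ln (1 / gibbs t x) \<le> N * ln (1 / min_local) + 2 * \<beta> * (N * (\<Delta> + 1))"
proof -
  let ?b = "\<beta> * (N * (\<Delta> + 1))"
  have b: "\<bar>\<beta> * avg_cost t y\<bar> \<le> ?b" if "y \<in> X" for y
    using avg_cost_bound[OF that, of t] beta_pos by (simp add: abs_mult)
  have "sum (weight t) X \<le> (\<Sum>y\<in>X. m y * exp ?b)"
    unfolding weight_def using b by (intro sum_mono mult_left_mono) (auto simp: abs_le_iff minus_le_iff)
  also have "\<dots> = exp ?b" using sum_law[of 0] by (simp add: sum_distrib_right[symmetric])
  finally have "log_partition t \<le> ln (exp ?b)" using partition_pos[of t] by (intro ln_mono) auto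
  then have "log_partition t \<le> ?b" by simp
  moreover have "ln (weight t x) = ln (m x) - \<beta> * avg_cost t x"
    using m_pos[OF x] by (simp add: weight_def ln_mult)
  moreover have "ln (min_local ^ card V) \<le> ln (m x)"
    using m_ge[OF x] min_local(1) by (intro ln_mono) auto
  then have "N * ln min_local \<le> ln (m x)" using min_local(1) by (simp add: ln_realpow)
  moreover have "ln (1 / gibbs t x) = log_partition t - ln (weight t x)"
    unfolding gibbs_def using partition_pos[of t] weight_pos[OF x, of t] by (simp add: ln_div)
  ultimately show ?thesis
    using b[OF x] min_local(1) by (simp add: ln_div abs_le_iff)
qed

text \<open>By \<open>kl_prior\<close> the log-partition functions cancel, leaving a linear term and
  the divergence of the law from \<open>gibbs t\<close>. The linear term has oscillation at most
  \<open>4 * \<beta> * (N * (\<Delta> + 1))\<close>; \<open>kl_le_excess\<close> with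
  \<open>ln_inverse_gibbs\<close> supplies the rest of the factor.\<close>

lemma loss_law_gibbs:
  "loss (Suc t) (law (Suc t)) - loss (Suc t) (gibbs t)
    \<le> wbound t * (1 + 6 * \<beta> * (N * (\<Delta> + 1)) + N * ln (1 / min_local))"
proof -
  let ?p = "law (Suc t)" and ?g = "gibbs t"
  let ?M = "N * (\<Delta> + 1)" and ?L = "N * ln (1 / min_local)"
  let ?h = "\<lambda>x. \<beta> * (cost V E (d (Suc t)) x - avg_cost t x)"
  have g: "\<And>x. x \<in> X \<Longrightarrow> ?g x \<ge> 0" using gibbs_pos less_imp_le by blast
  have eq: "loss (Suc t) ?p - loss (Suc t) ?g = (\<Sum>x\<in>X. (?p x - ?g x) * ?h x) + kl X ?p ?g"
    using kl_prior[OF pmf_nonneg sum_law, of "Suc t" t] kl_prior[OF g sum_gibbs, of t]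
    unfolding loss_def kl_self
    by (simp add: algebra_simps sum_subtractf sum.distrib sum_distrib_left del: action_dist.simps)
  have linear: "(\<Sum>x\<in>X. (?p x - ?g x) * ?h x) \<le> 4 * \<beta> * ?M * excess X ?p ?g"
  proof (rule sum_diff_le_excess[OF finite_X X_ne])
    fix x y assume x: "x \<in> X" and y: "y \<in> X"
    have "(cost V E (d (Suc t)) x - avg_cost t x) - (cost V E (d (Suc t)) y - avg_cost t y) \<le> 4 * ?M"
      using cost_bound[OF x, of "Suc t"] cost_bound[OF y, of "Suc t"] avg_cost_bound[OF x, of t]
        avg_cost_bound[OF y, of t]
      by linarith
    then have "\<beta> * ((cost V E (d (Suc t)) x - avg_cost t x) - (cost V E (d (Suc t)) y - avg_cost t y))
        \<le> \<beta> * (4 * ?M)"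
      using beta_pos by (intro mult_left_mono) auto
    then show "?h x - ?h y \<le> 4 * \<beta> * ?M" by (simp add: algebra_simps)
  qed (simp add: sum_law[of "Suc t"] sum_gibbs del: action_dist.simps)
  have entropy: "kl X ?p ?g \<le> (1 + (?L + 2 * \<beta> * ?M)) * excess X ?p ?g"
    by (intro kl_le_excess finite_X pmf_nonneg pmf_le_1 gibbs_pos ln_inverse_gibbs)
  have collect: "4 * \<beta> * ?M * e + (1 + (?L + 2 * \<beta> * ?M)) * e = (1 + 6 * \<beta> * ?M + ?L) * e" for e
    by (simp add: algebra_simps)
  have "loss (Suc t) ?p - loss (Suc t) ?g \<le> (1 + 6 * \<beta> * ?M + ?L) * excess X ?p ?g"
    unfolding eq collect[symmetric] by (rule add_mono[OF linear entropy])
  also have "\<dots> \<le> (1 + 6 * \<beta> * ?M + ?L) * wbound t"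
  proof (rule mult_left_mono[OF excess_law_gibbs])
    have "ln (1 / min_local) \<ge> 0" using min_local by (simp add: ln_div)
    then show "0 \<le> 1 + 6 * \<beta> * ?M + ?L" using beta_pos by simp
  qed
  finally show ?thesis by (subst mult.commute)
qed

lemma kl_prior_le:
  assumes "\<nu> \<in> distributions V q"
  shows "kl X (pmf \<nu>) m \<le> ln (1 / min_prior)"
proof -
  have sum: "sum (pmf \<nu>) X = 1"
    using assms finite_X by (intro sum_pmf_eq_1) (auto simp: distributions_def)
  have "pmf \<nu> x * ln (pmf \<nu> x / m x) \<le> pmf \<nu> x * ln (1 / min_prior)" if x: "x \<in> X" for x
  proof (cases "pmf \<nu> x = 0")
    case False
    then have p: "pmf \<nu> x > 0" by (simp add: order.strict_iff_order)
    have "pmf \<nu> x / m x \<le> 1 / min_prior"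
      using min_prior(1) min_prior(2)[OF x] by (intro frac_le) (auto simp: pmf_le_1)
    then have "ln (pmf \<nu> x / m x) \<le> ln (1 / min_prior)"
      using p m_pos[OF x] by (intro ln_mono) auto
    then show ?thesis using p by (intro mult_left_mono) auto
  qed simp
  then have "kl X (pmf \<nu>) m \<le> (\<Sum>x\<in>X. pmf \<nu> x * ln (1 / min_prior))"
    unfolding kl_def by (intro sum_mono)
  also have "\<dots> = ln (1 / min_prior)" using sum by (simp add: sum_distrib_right[symmetric])
  finally show ?thesis .
qed

lemma regret_leI:
  assumes "\<And>\<nu>. \<nu> \<in> distributions V q \<Longrightarrow>
    (\<Sum>t=1..T. inst_loss V E q \<beta> \<mu> (d t) (action_dist V E q \<beta> \<mu> d t))
      - (\<Sum>t=1..T. inst_loss V E q \<beta> \<mu> (d t) \<nu>) \<le> B"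
  shows "regret V E q \<beta> \<mu> d T \<le> B"
proof -
  have "(\<Sum>t=1..T. inst_loss V E q \<beta> \<mu> (d t) (action_dist V E q \<beta> \<mu> d t)) - B
      \<le> (INF \<nu>\<in>distributions V q. \<Sum>t=1..T. inst_loss V E q \<beta> \<mu> (d t) \<nu>)"
  proof (rule cINF_greatest)
    show "distributions V q \<noteq> {}" using distributions_nonempty[OF finite_V] mu_supp by metis
  qed (use assms in \<open>simp add: algebra_simps\<close>)
  then show ?thesis unfolding regret_def by linarith
qed

text \<open>Three contributions: the tracking error of the dynamics, the excess loss of the Gibbs
  sequence, and the comparator's divergence from the prior, which enters once as the
  regulariser.\<close>

lemma regret_le:
  "regret V E q \<beta> \<mu> d T \<le> ln (1 / min_prior) + 4 * (\<beta> * (N * (\<Delta> + 1)))\<^sup>2 * ln (real T + 1)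
    + N / (1 - \<Delta> * \<beta>) * (\<beta> * N\<^sup>2 * (\<Delta> + 1)) * ln (real T + 1)
      * (1 + 6 * \<beta> * (N * (\<Delta> + 1)) + N * ln (1 / min_local))"
proof (rule regret_leI)
  fix \<nu> assume \<nu>: "\<nu> \<in> distributions V q"
  let ?C = "1 + 6 * \<beta> * (N * (\<Delta> + 1)) + N * ln (1 / min_local)"
  have sum: "sum (pmf \<nu>) X = 1"
    using \<nu> finite_X by (intro sum_pmf_eq_1) (auto simp: distributions_def)
  have shift: "(\<Sum>t=1..T. g t) = (\<Sum>t<T. g (Suc t))" for g :: "nat \<Rightarrow> real"
    using sum.atLeast1_atMost_eq by auto
  have C: "?C \<ge> 0"
  proof -
    have "ln (1 / min_local) \<ge> 0" using min_local by (simp add: ln_div)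
    then show ?thesis using beta_pos by simp
  qed
  have "(\<Sum>t<T. loss (Suc t) (law (Suc t))) - (\<Sum>t<T. loss (Suc t) (gibbs t)) \<le> (\<Sum>t<T. wbound t * ?C)"
    unfolding sum_subtractf[symmetric] by (intro sum_mono loss_law_gibbs)
  also have "\<dots> = (\<Sum>t<T. wbound t) * ?C" by (simp only: sum_distrib_right)
  also have "\<dots> \<le> N / (1 - \<Delta> * \<beta>) * (\<beta> * N\<^sup>2 * (\<Delta> + 1)) * ln (real T + 1) * ?C"
    by (intro mult_right_mono sum_wbound C)
  finally have 1: "(\<Sum>t=1..T. loss t (law t)) - (\<Sum>t<T. loss (Suc t) (gibbs t))
      \<le> N / (1 - \<Delta> * \<beta>) * (\<beta> * N\<^sup>2 * (\<Delta> + 1)) * ln (real T + 1) * ?C"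
    unfolding shift .
  have 2: "(\<Sum>t<T. loss (Suc t) (gibbs t))
      \<le> - (real T + 1) * log_partition T + 4 * (\<beta> * (N * (\<Delta> + 1)))\<^sup>2 * ln (real T + 1)"
    using sum_loss_gibbs[of T] mult_left_mono[OF harmonic_le_ln[of T], of "4 * (\<beta> * (N * (\<Delta> + 1)))\<^sup>2"]
    by (simp del: mult_minus_left)
  have "kl X (pmf \<nu>) (gibbs T) \<ge> 0"
    by (intro kl_nonneg) (simp_all add: gibbs_pos sum sum_gibbs)
  then have "(real T + 1) * (kl X (pmf \<nu>) (gibbs T) - log_partition T) \<ge> (real T + 1) * (- log_partition T)"
    by (intro mult_left_mono) auto
  then have 3: "- (real T + 1) * log_partition T \<le> (\<Sum>t=1..T. loss t (pmf \<nu>)) + ln (1 / min_prior)"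
    unfolding minus_mult_commute[of "real T + 1"]
    using cumulative_loss[OF pmf_nonneg sum, of T] kl_prior_le[OF \<nu>] by linarith
  show "(\<Sum>t=1..T. inst_loss V E q \<beta> \<mu> (d t) (action_dist V E q \<beta> \<mu> d t))
      - (\<Sum>t=1..T. inst_loss V E q \<beta> \<mu> (d t) \<nu>)
    \<le> ln (1 / min_prior) + 4 * (\<beta> * (N * (\<Delta> + 1)))\<^sup>2 * ln (real T + 1)
      + N / (1 - \<Delta> * \<beta>) * (\<beta> * N\<^sup>2 * (\<Delta> + 1)) * ln (real T + 1) * ?C"
    unfolding inst_loss_eq using 1 2 3 by linarith
qed

text \<open>There is a single profile, hence a single distribution. The case is separate because
  \<open>ln (q^2 / min_local)\<close> is 0 here and cannot absorb a constant.\<close>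

lemma regret_trivial:
  assumes "q = 1"
  shows "regret V E q \<beta> \<mu> d T \<le> 0"
proof (rule regret_leI)
  fix \<nu> assume \<nu>: "\<nu> \<in> distributions V q"
  obtain x where x: "x \<in> X" using X_ne by blast
  have "y = x" if "y \<in> X" for y
    using that x assms unfolding profiles_def by (intro PiE_ext[of y V "\<lambda>_. {1..q}" x]) (auto simp: PiE_iff)
  then have X: "X = {x}" using x by blast
  have "action_dist V E q \<beta> \<mu> d t = \<nu>" for t
    using set_action_dist[of t] \<nu> unfolding X distributions_def by (simp add: set_pmf_subset_singleton)
  then show "(\<Sum>t=1..T. inst_loss V E q \<beta> \<mu> (d t) (action_dist V E q \<beta> \<mu> d t))
      - (\<Sum>t=1..T. inst_loss V E q \<beta> \<mu> (d t) \<nu>) \<le> 0" by simp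
qed

end

section \<open>Conversion to the stated form of the bound\<close>

text \<open>The constant \<open>C\<close> is dominated by \<open>ln T\<close> from time \<open>exp C\<close> on; \<open>burn_in\<close> pays for the time
  before.\<close>

definition burn_in :: "real \<Rightarrow> nat \<Rightarrow> nat \<Rightarrow> real" where
  "burn_in \<beta> \<Delta> n = (let C = 1 + 6 * \<beta> * (real n * (real \<Delta> + 1)) in
     max 1 (real n / (1 - real \<Delta> * \<beta>) * max (real n) (\<beta> * (real n)\<^sup>2 * (real \<Delta> + 1)) * C * exp C))"

text \<open>Either \<open>C \<le> ln T\<close>, or \<open>T < exp C\<close>, and then
  \<open>ln (T + 1) \<le> T\<close> bounds the left side by \<open>A * C * exp C\<close>.\<close>

lemma absorb_constant:
  fixes A C L T1 :: real and T :: nat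
  assumes "T \<ge> 1" "A \<ge> 0" "C \<ge> 0" "L \<ge> 1" "T1 \<ge> A * C * exp C"
  shows "A * ln (real T + 1) * C \<le> A * ln (real T + 1) * ln (real T) + T1 * L"
proof -
  have ln0: "ln (real T + 1) \<ge> 0" "ln (real T) \<ge> 0" using assms(1) by auto
  have "A * C * exp C \<ge> 0" using assms(2,3) by simp
  then have T10: "T1 \<ge> 0" using assms(5) by linarith
  show ?thesis
  proof (cases "C \<le> ln (real T)")
    case True
    then have "A * ln (real T + 1) * C \<le> A * ln (real T + 1) * ln (real T)"
      using assms ln0 by (intro mult_left_mono) auto
    moreover have "T1 * L \<ge> 0" using T10 assms(4) by simp
    ultimately show ?thesis by linarith
  next
    case False
    then have T: "real T < exp C" using assms(1) ln_ge_iff[of "real T" C] by simp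
    have "ln (real T + 1) \<le> real T" using ln_add_one_self_le_self[of "real T"] by (simp add: add.commute)
    then have "(A * C) * ln (real T + 1) \<le> (A * C) * exp C"
      using T assms(2,3) by (intro mult_left_mono) auto
    then have "A * ln (real T + 1) * C \<le> T1" using assms(5) by (simp add: mult_ac)
    moreover have "T1 * 1 \<le> T1 * L" using T10 assms(4) by (intro mult_left_mono) auto
    moreover have "A * ln (real T + 1) * ln (real T) \<ge> 0" using assms(2) ln0 by simp
    ultimately show ?thesis by linarith
  qed
qed

text \<open>The term with factor 4 in \<open>regret_le\<close> is \<open>2 * S\<close>: one
  \<open>S\<close> stands in the target, the other is below \<open>(a * N) * S\<close>. In the
  tracking error, \<open>\<beta> * N\<^sup>2 * (\<Delta> + 1)\<close> is at most \<open>K\<close>,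
  \<open>Ld\<close> is at most \<open>Lq\<close>, and \<open>C\<close> is traded for
  \<open>ln T\<close> and the burn-in term.\<close>

lemma (in network_game) regret_bound:
  assumes T: "T \<ge> 1"
  defines "K \<equiv> max N (\<beta> * N\<^sup>2 * (\<Delta> + 1))"
  shows "regret V E q \<beta> \<mu> d T \<le>
    N / (1 - \<Delta> * \<beta>) *
      (2 * \<beta>\<^sup>2 * N ^ 3 * (\<Delta> + 1)\<^sup>2 + K * (N * ln ((real q)\<^sup>2 / min_local) + ln (real T))) * ln (real T + 1)
    + 2 * (\<beta> * N * (\<Delta> + 1))\<^sup>2 * ln (real T + 1)
    + burn_in \<beta> (max_degree V E) (card V) * N * ln ((real q)\<^sup>2 / min_local)
    + 2 * \<beta> * N ^ 3 * (\<Delta> + 1) / (1 - \<Delta> * \<beta>)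
    + ln (1 / min_prior)"
proof -
  define a where "a = N / (1 - \<Delta> * \<beta>)"
  define l where "l = ln (real T + 1)"
  define T1 where "T1 = burn_in \<beta> (max_degree V E) (card V)"
  define C where "C = 1 + 6 * \<beta> * (N * (\<Delta> + 1))"
  define Lq Ld where "Lq = ln ((real q)\<^sup>2 / min_local)" and "Ld = ln (1 / min_local)"
  define S where "S = 2 * (\<beta> * N * (\<Delta> + 1))\<^sup>2 * l"
  have gap: "1 - \<Delta> * \<beta> > 0" "1 - \<Delta> * \<beta> \<le> 1" using subcritical beta_pos by auto
  have a1: "a \<ge> 1"
    unfolding a_def using gap N_ge_1 by (subst le_divide_eq) auto
  have l0: "l \<ge> 0" and lT: "ln (real T) \<ge> 0" using T by (auto simp: l_def)
  have T1: "T1 \<ge> 1" "T1 \<ge> a * K * C * exp C"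
    unfolding T1_def burn_in_def Let_def a_def K_def C_def by auto
  have C0: "C \<ge> 0" using beta_pos by (simp add: C_def)
  have K: "K \<ge> \<beta> * N\<^sup>2 * (\<Delta> + 1)" "K \<ge> 0" using N_ge_1 by (auto simp: K_def)
  have Ld: "Ld \<ge> 0" using min_local by (simp add: Ld_def ln_div)
  have Lq_eq: "Lq = 2 * ln (real q) + Ld"
    using min_local q_pos by (simp add: Lq_def Ld_def ln_div ln_realpow)
  have LqLd: "Lq \<ge> Ld" using q_pos by (simp add: Lq_eq)
  have S0: "S \<ge> 0" using l0 by (simp add: S_def)
  have last: "2 * \<beta> * N ^ 3 * (\<Delta> + 1) / (1 - \<Delta> * \<beta>) \<ge> 0"
    using gap beta_pos by (intro divide_nonneg_nonneg) auto
  have prior: "ln (1 / min_prior) \<ge> 0" using min_prior by (simp add: ln_div)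
  have aK: "a * K \<ge> 0" "a * K * l \<ge> 0" using a1 K l0 by simp_all
  have target: "a * (2 * \<beta>\<^sup>2 * N ^ 3 * (\<Delta> + 1)\<^sup>2 + K * (N * Lq + ln (real T))) * l
      = (a * N) * S + a * K * l * (N * Lq) + a * K * l * ln (real T)"
    by (simp add: S_def power2_eq_square power3_eq_cube algebra_simps)
  have aN: "S \<le> (a * N) * S"
    using mult_right_mono[OF _ S0, of 1 "a * N"] a1 N_ge_1 mult_mono[of 1 a 1 N] by simp
  have NLq: "a * K * l * (N * Ld) \<le> a * K * l * (N * Lq)"
    using aK LqLd N_ge_1 by (intro mult_left_mono) auto
  have T1Lq: "T1 * N * Lq \<ge> 0" using T1 Ld LqLd by simp
  have "regret V E q \<beta> \<mu> d T \<le> (a * N) * S + a * K * l * (N * Lq) + a * K * l * ln (real T) + S + T1 * N * Lq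
      + ln (1 / min_prior)"
  proof (cases "q = 1")
    case True
    have "(a * N) * S \<ge> 0" "a * K * l * (N * Lq) \<ge> 0" "a * K * l * ln (real T) \<ge> 0"
      using aK a1 S0 Ld LqLd lT by simp_all
    then show ?thesis using regret_trivial[OF True, of T] S0 T1Lq prior by linarith
  next
    case False
    \<comment> \<open>Two actions suffice for \<open>Lq \<ge> 2 * ln 2 \<ge> 1\<close>, so that the
      burn-in term is at least \<open>T1\<close>.\<close>
    then have "real q \<ge> 2" using q_pos by simp
    then have "ln (real q) \<ge> ln 2" by (intro ln_mono) auto
    moreover have "ln (2::real) \<ge> 1 / 2"
      using ln_le_minus_one[of "1 / 2 :: real"] by (simp add: ln_div)
    ultimately have "Lq \<ge> 1" using Ld unfolding Lq_eq by linarith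
    then have NL: "N * Lq \<ge> 1" using mult_mono[of 1 N 1 Lq] N_ge_1 by simp
    have "a * K * l * C \<le> a * K * l * ln (real T) + T1 * (N * Lq)"
      unfolding l_def using absorb_constant[OF T aK(1) C0 NL T1(2)] .
    moreover have "a * (\<beta> * N\<^sup>2 * (\<Delta> + 1)) * l * (C + N * Ld) \<le> a * K * l * (C + N * Ld)"
      using K a1 l0 C0 Ld by (intro mult_right_mono mult_left_mono) auto
    moreover have "a * K * l * (C + N * Ld) = a * K * l * C + a * K * l * (N * Ld)"
      by (rule distrib_left)
    moreover have "4 * (\<beta> * (N * (\<Delta> + 1)))\<^sup>2 * l = 2 * S"
      by (simp add: S_def mult.assoc)
    moreover have "regret V E q \<beta> \<mu> d T \<le> ln (1 / min_prior) + 4 * (\<beta> * (N * (\<Delta> + 1)))\<^sup>2 * l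
      + a * (\<beta> * N\<^sup>2 * (\<Delta> + 1)) * l * (C + N * Ld)"
      using regret_le[of T] unfolding a_def l_def C_def Ld_def .
    moreover have "T1 * N * Lq = T1 * (N * Lq)" by (rule mult.assoc)
    ultimately show ?thesis using NLq aN by linarith
  qed
  then show ?thesis
    using last target
    unfolding a_def[symmetric] l_def[symmetric] T1_def[symmetric] Lq_def[symmetric] S_def[symmetric]
    by linarith
qed

lemma avg_local_cost_cong:
  "(\<And>s. s \<in> {1..t} \<Longrightarrow> d s = d' s) \<Longrightarrow> avg_local_cost V E d t = avg_local_cost V E d' t"
  by (simp add: avg_local_cost_def fun_eq_iff)

text \<open>The strategy is causal, so a cost sequence may be altered beyond the current
  time.\<close>

lemma action_dist_cong:
  "(\<And>s. s \<in> {1..t} \<Longrightarrow> d s = d' s) \<Longrightarrow> action_dist V E q \<beta> \<mu> d t = action_dist V E q \<beta> \<mu> d' t"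
proof (induction t)
  case (Suc t)
  have "avg_local_cost V E d t = avg_local_cost V E d' t"
    by (intro avg_local_cost_cong Suc.prems) simp
  then have "glauber_kernel V E q \<beta> \<mu> d t = glauber_kernel V E q \<beta> \<mu> d' t"
    by (simp only: glauber_kernel_def[abs_def] local_update_def)
  then show ?case using Suc by simp
qed simp

lemma regret_cong:
  assumes "\<And>s. s \<in> {1..T} \<Longrightarrow> d s = d' s"
  shows "regret V E q \<beta> \<mu> d T = regret V E q \<beta> \<mu> d' T"
proof -
  have "action_dist V E q \<beta> \<mu> d t = action_dist V E q \<beta> \<mu> d' t" if "t \<in> {1..T}" for t
    using that by (intro action_dist_cong assms) auto
  then have "(\<Sum>t=1..T. inst_loss V E q \<beta> \<mu> (d t) (action_dist V E q \<beta> \<mu> d t))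
      = (\<Sum>t=1..T. inst_loss V E q \<beta> \<mu> (d' t) (action_dist V E q \<beta> \<mu> d' t))"
    using assms by (intro sum.cong) auto
  moreover have "(\<Sum>t=1..T. inst_loss V E q \<beta> \<mu> (d t) \<nu>) = (\<Sum>t=1..T. inst_loss V E q \<beta> \<mu> (d' t) \<nu>)" for \<nu>
    using assms by (intro sum.cong) auto
  ultimately show ?thesis unfolding regret_def by presburger
qed

theorem theorem1:
  shows "\<exists>T1 :: real \<Rightarrow> nat \<Rightarrow> nat \<Rightarrow> real. (\<forall>\<beta> \<Delta> n. T1 \<beta> \<Delta> n > 0) \<and>
    (\<forall>(V :: 'v set) (E :: 'v set set) (q :: nat) (\<mu> :: 'v \<Rightarrow> nat pmf) (\<beta> :: real)
        (\<Phi> :: (nat \<Rightarrow> real) set) (\<Psi> :: (nat \<Rightarrow> nat \<Rightarrow> real) set) (T :: nat).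
      simple_graph V E \<longrightarrow>
      q \<ge> 1 \<longrightarrow>
      (\<forall>v\<in>V. set_pmf (\<mu> v) = {1..q}) \<longrightarrow>
      (\<forall>\<phi>\<in>\<Phi>. \<forall>a\<in>{1..q}. \<phi> a \<in> {-1..1}) \<longrightarrow>
      (\<forall>\<psi>\<in>\<Psi>. \<forall>a\<in>{1..q}. \<forall>b\<in>{1..q}. \<psi> a b \<in> {-1..1}) \<longrightarrow>
      \<beta> > 0 \<longrightarrow>
      real (max_degree V E) * \<beta> < 1 \<longrightarrow>
      T \<ge> 1 \<longrightarrow>
      (let \<Delta> = real (max_degree V E);
           N = real (card V);
           K = max N (\<beta> * N^2 * (\<Delta> + 1));
           \<theta>d = (MIN v\<in>V. MIN a\<in>{1..q}. pmf (\<mu> v) a);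
           \<theta> = (MIN x\<in>profiles V q. pmf (initial_dist V \<mu>) x)
       in worst_regret V E q \<beta> \<mu> \<Phi> \<Psi> T \<le> ereal (
            N / (1 - \<Delta> * \<beta>) *
              (2 * \<beta>^2 * N^3 * (\<Delta> + 1)^2 + K * (N * ln ((real q)^2 / \<theta>d) + ln (real T))) *
              ln (real T + 1)
            + 2 * (\<beta> * N * (\<Delta> + 1))^2 * ln (real T + 1)
            + T1 \<beta> (max_degree V E) (card V) * N * ln ((real q)^2 / \<theta>d)
            + 2 * \<beta> * N^3 * (\<Delta> + 1) / (1 - \<Delta> * \<beta>)
            + ln (1 / \<theta>))))"
\<comment> \<open>The witness depends on \<beta>, \<Delta> and \<open>card V\<close> alone, and the
  maximum with 1 in it gives positivity for all arguments.\<close>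
proof (intro exI[of _ burn_in] conjI allI impI)
  show "burn_in \<beta> \<Delta> n > 0" for \<beta> \<Delta> n
    by (auto simp: burn_in_def Let_def less_max_iff_disj)
next
  fix V :: "'v set" and E q and \<mu> :: "'v \<Rightarrow> nat pmf" and \<beta> \<Phi> \<Psi> and T :: nat
  assume A: "simple_graph V E" "q \<ge> 1" "\<forall>v\<in>V. set_pmf (\<mu> v) = {1..q}"
    "\<forall>\<phi>\<in>\<Phi>. \<forall>a\<in>{1..q}. \<phi> a \<in> {-1..1 :: real}"
    "\<forall>\<psi>\<in>\<Psi>. \<forall>a\<in>{1..q}. \<forall>b\<in>{1..q}. \<psi> a b \<in> {-1..1 :: real}"
    "\<beta> > 0" "real (max_degree V E) * \<beta> < 1" "T \<ge> 1"
  show "let \<Delta> = real (max_degree V E);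
           N = real (card V);
           K = max N (\<beta> * N^2 * (\<Delta> + 1));
           \<theta>d = (MIN v\<in>V. MIN a\<in>{1..q}. pmf (\<mu> v) a);
           \<theta> = (MIN x\<in>profiles V q. pmf (initial_dist V \<mu>) x)
       in worst_regret V E q \<beta> \<mu> \<Phi> \<Psi> T \<le> ereal (
            N / (1 - \<Delta> * \<beta>) *
              (2 * \<beta>^2 * N^3 * (\<Delta> + 1)^2 + K * (N * ln ((real q)^2 / \<theta>d) + ln (real T))) *
              ln (real T + 1)
            + 2 * (\<beta> * N * (\<Delta> + 1))^2 * ln (real T + 1)
            + burn_in \<beta> (max_degree V E) (card V) * N * ln ((real q)^2 / \<theta>d)
            + 2 * \<beta> * N^3 * (\<Delta> + 1) / (1 - \<Delta> * \<beta>)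
            + ln (1 / \<theta>))"
    unfolding Let_def worst_regret_def
  proof (intro SUP_least, unfold ereal_less_eq)
    fix d assume d: "d \<in> {1..T} \<rightarrow> decompositions V E \<Phi> \<Psi>"
    \<comment> \<open>Padding by \<open>d 1\<close>, which is a valid decomposition since
      \<open>T \<ge> 1\<close>.\<close>
    define d' where "d' s = (if s \<in> {1..T} then d s else d 1)" for s
    interpret network_game V E q \<mu> \<beta> \<Phi> \<Psi> d'
    proof
      show "d' t \<in> decompositions V E \<Phi> \<Psi>" for t
        using d A(8) by (auto simp: d'_def)
    qed (use A in \<open>auto simp: abs_le_iff\<close>)
    have "regret V E q \<beta> \<mu> d T = regret V E q \<beta> \<mu> d' T"
      by (rule regret_cong) (simp add: d'_def)
    with regret_bound[OF A(8)] show "regret V E q \<beta> \<mu> d T \<le> N / (1 - \<Delta> * \<beta>) *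
              (2 * \<beta>^2 * N^3 * (\<Delta> + 1)^2 + max N (\<beta> * N^2 * (\<Delta> + 1)) *
                (N * ln ((real q)^2 / (MIN v\<in>V. MIN a\<in>{1..q}. pmf (\<mu> v) a)) + ln (real T))) *
              ln (real T + 1)
            + 2 * (\<beta> * N * (\<Delta> + 1))^2 * ln (real T + 1)
            + burn_in \<beta> (max_degree V E) (card V) * N * ln ((real q)^2 / (MIN v\<in>V. MIN a\<in>{1..q}. pmf (\<mu> v) a))
            + 2 * \<beta> * N^3 * (\<Delta> + 1) / (1 - \<Delta> * \<beta>)
            + ln (1 / (MIN x\<in>profiles V q. pmf (initial_dist V \<mu>) x))"
      unfolding min_local_def min_prior_def by simp
  qed
qed

end
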